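(* Let $\mathcal{G}$ be the family of (connected) graphs of pathwidth two, and let $\delta_{\mathcal{G}}(n)=\max\{\delta(\mathcal{A}(G)) : G\in\mathcal{G},\ |V(G)|=n\}$. Then $\delta_{\mathcal{G}}(n)=\Theta(n\log n)$.
   Context: All graphs are finite, simple and connected. For a graph $G=(V,E)$, a search tree on $G$ is a rooted tree with vertex set $V$ defined recursively: its root is some vertex $r\in V$, and $r$ is joined to the roots of search trees on each connected component of $G-r$. The tubes of a search tree are the vertex sets of its subtrees. Two search trees on $G$ are related by a rotation if their sets of tubes have symmetric difference of size exactly two. The graph associahedron $\mathcal{A}(G)$ is a polytope whose skeleton is isomorphic to the graph on search trees of $G$ with adjacency given by rotations; $\delta(\mathcal{A}(G))$ is the diameter of this graph. Pathwidth is the usual graph parameter (one less than the smallest clique number of an interval supergraph of $G$). *)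

theory Defs
  imports
    "Graph_Theory.Graph_Theory"
    "HOL-Library.FSet"
    "HOL-Library.Landau_Symbols"
begin

text \<open>A finite simple graph is a \<^locale>\<open>pair_graph\<close>, i.e. a finite symmetric loop-free digraph whose
  arcs are ordered pairs of vertices; an edge is a pair of opposite arcs. In such a graph the
  strongly connected components \<^const>\<open>pre_digraph.sccs\<close> are the connected components.\<close>

datatype (tree_verts: 'a) rtree = Node 'a "'a rtree fset"

text \<open>The map \<open>f\<close> chooses one search tree on each connected component of \<open>G - r\<close>. It is
  automatically injective on the components, because their vertex sets are disjoint.\<close>

inductive search_tree :: "('a, 'b) pre_digraph \<Rightarrow> 'a rtree \<Rightarrow> bool" where
  "\<lbrakk>r \<in> verts G;
    \<And>H. H \<in> pre_digraph.sccs (pre_digraph.del_vert G r) \<Longrightarrow> search_tree H (f H);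
    fset ts = f ` pre_digraph.sccs (pre_digraph.del_vert G r)\<rbrakk>
   \<Longrightarrow> search_tree G (Node r ts)"

primrec subtrees :: "'a rtree \<Rightarrow> 'a rtree set" where
  "subtrees (Node r ts) = insert (Node r ts) (\<Union> (fset (subtrees |`| ts)))"

definition tubes :: "'a rtree \<Rightarrow> 'a set set" where
  "tubes T = tree_verts ` subtrees T"

text \<open>The skeleton of the graph associahedron.\<close>

definition rotation_graph :: "('a, 'b) pre_digraph \<Rightarrow> 'a rtree pair_pre_digraph" where
  "rotation_graph G = \<lparr>
     pverts = {T. search_tree G T},
     parcs = {(S, T). search_tree G S \<and> search_tree G T \<and>
                card (sym_diff (tubes S) (tubes T)) = 2}\<rparr>"

lemma wf_digraph_rotation_graph: "wf_digraph (with_proj (rotation_graph G))"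
  by unfold_locales (auto simp: rotation_graph_def)

text \<open>Distances are extended reals, being \<open>\<infinity>\<close> between vertices not joined by a walk.\<close>

definition graph_diameter :: "('a, 'b) pre_digraph \<Rightarrow> ereal" where
  "graph_diameter R = (SUP u \<in> verts R. SUP v \<in> verts R. wf_digraph.\<mu> R (\<lambda>_. 1) u v)"

definition clique_number :: "('a, 'b) pre_digraph \<Rightarrow> nat" where
  "clique_number G = Max {k. \<exists>K. complete_digraph k K \<and> subgraph K G}"

definition interval_graph :: "('a, 'b) pre_digraph \<Rightarrow> bool" where
  "interval_graph G \<longleftrightarrow> graph G \<and>
     (\<exists>l r :: 'a \<Rightarrow> real.
        (\<forall>v \<in> verts G. l v \<le> r v) \<and>
        (\<forall>u \<in> verts G. \<forall>v \<in> verts G. u \<noteq> v \<longrightarrow>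
           (u \<rightarrow>\<^bsub>G\<^esub> v \<longleftrightarrow> {l u..r u} \<inter> {l v..r v} \<noteq> {})))"

definition pathwidth :: "'a pair_pre_digraph \<Rightarrow> nat" where
  "pathwidth G =
     (LEAST k. \<exists>H :: 'a pair_pre_digraph.
        interval_graph (with_proj H) \<and> subgraph (with_proj G) (with_proj H) \<and>
        clique_number (with_proj H) = k) - 1"

text \<open>Vertices are natural numbers, so that every finite graph occurs up to isomorphism.\<close>

definition pathwidth_two_graphs :: "nat pair_pre_digraph set" where
  "pathwidth_two_graphs =
     {G. pair_graph G \<and> Digraph_Component.connected (with_proj G) \<and> pathwidth G = 2}"

text \<open>Diameters lie in \<open>\<nat> \<union> {\<infinity>}\<close>, so a finite supremum over a nonempty family is a maximum.
  Note that \<^const>\<open>real_of_ereal\<close> sends \<open>\<plusminus>\<infinity>\<close> to \<open>0\<close>. Hence a positive lower bound on the real value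
  excludes both an unbounded family and (the supremum being \<open>-\<infinity>\<close>) an empty one.\<close>

definition max_diameter :: "nat pair_pre_digraph set \<Rightarrow> nat \<Rightarrow> real" where
  "max_diameter \<G> n =
     real_of_ereal (SUP G \<in> {G \<in> \<G>. card (pverts G) = n}.
        graph_diameter (with_proj (rotation_graph (with_proj G))))"

end

theory Submission
  imports Defs
begin

text \<open>
  Upper bound. Rotating a vertex \<open>r\<close> to the root of a search tree takes at most \<open>n\<close> rotations, after
  which the components of \<open>G - r\<close> can be treated independently. A graph of pathwidth two has a
  separator of at most three vertices, namely a clique of an interval supergraph, all of whose
  components have at most \<open>n / 2\<close> vertices. Moving the separators to the top of both trees,
  recursively, costs \<open>O(n)\<close> on each of \<open>O(log n)\<close> levels.

  Lower bound. On the square of the path \<open>0, \<dots>, n - 1\<close>, an interval graph, consider for each dyadic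
  interval \<open>I\<close> the ancestors of its left end point that lie in \<open>I\<close>, listed from the root down, and count
  how often this list alternates between the two halves of \<open>I\<close>. A connected set meets \<open>I\<close> in a
  connected set, so a rotation of \<open>u\<close> and \<open>v\<close> changes this number only if the midpoint of \<open>I\<close> separates
  \<open>u\<close> from \<open>v\<close>, which singles out one \<open>I\<close>, and then by at most four. Summed over all \<open>I\<close>, the number
  is zero for the elimination order \<open>0, \<dots>, n - 1\<close>. It is of order \<open>n log n\<close> if the odd vertices are
  eliminated first, in bit-reversal order: the even vertices keep the rest connected meanwhile.
\<close>

text \<open>A search tree does not determine an elimination order, so alternations of the order
  itself are no invariant of the tree. The ancestors of one vertex form a chain, whose order the
  tree does determine; hence each dyadic interval gets a single observing vertex. The resulting sum
  is an analogue of Wilber's interleave bound for binary search trees, where bit reversal is a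
  classical hard input. The path itself would not do: removing one of its vertices hides everything
  beyond it from the observers on the other side. In the square a gap of one vertex is harmless, and
  the observers, being left end points of intervals of even length, are even. Rotations are given
  only through families of tubes. Both bounds rest on a dictionary: a transposition of adjacent
  entries of an elimination order is a rotation or changes nothing, and conversely every rotation is
  such a transposition in a suitable order. One direction produces short walks, the other limits the
  effect of a rotation on the potential.\<close>

section \<open>Auxiliary facts on relations, sets and lists\<close>

lemma relpow_mono_exponent: "Id \<subseteq> R \<Longrightarrow> (x, y) \<in> R ^^ d \<Longrightarrow> d \<le> e \<Longrightarrow> (x, y) \<in> R ^^ e"
proof (induction e)
  case (Suc e)
  then show ?case by (cases "d = Suc e") (auto intro: relpow_Suc_I)
qed simp

lemma relpow_symI: "sym R \<Longrightarrow> (x, y) \<in> R ^^ d \<Longrightarrow> (y, x) \<in> R ^^ d"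
proof (induction d arbitrary: y)
  case (Suc d)
  then show ?case by (metis relpow_Suc_E relpow_Suc_I2 symD)
qed simp

lemma card_two_eq: "card D = 2 \<Longrightarrow> A \<in> D \<Longrightarrow> B \<in> D \<Longrightarrow> A \<noteq> B \<Longrightarrow> D = {A, B}"
  by (auto simp: card_2_iff)

lemma sym_diff_exchange:
  "sym_diff (insert A Z) Q = {A, B} \<Longrightarrow> A \<notin> Q \<Longrightarrow> B \<in> Q \<Longrightarrow> A \<notin> Z \<Longrightarrow> Q = insert B Z"
  by (simp add: set_eq_iff) metis

text \<open>Concatenation suffices, since only the restriction to each block matters. This glues
  elimination orders of the components into one order of their union.\<close>

lemma merge_lists:
  assumes "finite C" "\<And>H K. H \<in> C \<Longrightarrow> K \<in> C \<Longrightarrow> H \<noteq> K \<Longrightarrow> H \<inter> K = {}"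
    and "\<And>H. H \<in> C \<Longrightarrow> set (s H) = H \<and> distinct (s H)"
  shows "\<exists>t. distinct t \<and> set t = \<Union> C \<and> (\<forall>H\<in>C. filter (\<lambda>x. x \<in> H) t = s H)"
  using assms
proof (induction C rule: finite_induct)
  case (insert K C)
  then obtain t where t: "distinct t" "set t = \<Union> C" "\<forall>H\<in>C. filter (\<lambda>x. x \<in> H) t = s H" by auto
  have dis: "K \<inter> H = {}" if "H \<in> C" for H using insert.prems(1)[of K H] insert.hyps that by auto
  have K: "set (s K) = K" "distinct (s K)" using insert.prems(2)[of K] by auto
  have "filter (\<lambda>x. x \<in> K) (s K @ t) = s K"
  proof -
    have "filter (\<lambda>x. x \<in> K) t = []" using dis t(2) by (auto simp: filter_empty_conv)
    moreover have "filter (\<lambda>x. x \<in> K) (s K) = s K" using K by (intro filter_True) simp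
    ultimately show ?thesis by simp
  qed
  moreover have "filter (\<lambda>x. x \<in> H) (s K @ t) = s H" if "H \<in> C" for H
    using K dis[OF that] t(3) that by (auto simp: filter_empty_conv)
  moreover have "distinct (s K @ t)" proof -
    have "K \<inter> \<Union> C = {}" using dis by blast
    then show ?thesis using K t by simp
  qed
  moreover have "set (s K @ t) = \<Union> (insert K C)" using K t by simp
  ultimately have "distinct (s K @ t) \<and> set (s K @ t) = \<Union> (insert K C) \<and>
      (\<forall>H\<in>insert K C. filter (\<lambda>x. x \<in> H) (s K @ t) = s H)"
    by auto
  then show ?case by blast
qed simp

section \<open>Components of vertex sets\<close>

text \<open>Search trees recurse into induced subgraphs. With the edge relation fixed, only the
  vertex set varies, and graphs reappear only in the final translation.\<close>

locale symmetric_relation =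
  fixes E :: "'a rel"
  assumes sym_E: "sym E"
begin

text \<open>\<open>rtrancl\<close> relates every element to itself, so membership in
  \<open>U\<close> is required separately: a removed vertex must not count as joined to
  itself.\<close>

definition joined :: "'a set \<Rightarrow> 'a \<Rightarrow> 'a \<Rightarrow> bool" where
  "joined U x y \<longleftrightarrow> x \<in> U \<and> y \<in> U \<and> (x, y) \<in> (E \<inter> U \<times> U)\<^sup>*"

definition component :: "'a set \<Rightarrow> 'a \<Rightarrow> 'a set" where
  "component U x = {y. joined U x y}"

definition components :: "'a set \<Rightarrow> 'a set set" where
  "components U = component U ` U"

definition connected_set :: "'a set \<Rightarrow> bool" where
  "connected_set U \<longleftrightarrow> U \<noteq> {} \<and> (\<forall>x\<in>U. \<forall>y\<in>U. joined U x y)"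

lemma joined_in: "joined U x y \<Longrightarrow> x \<in> U" "joined U x y \<Longrightarrow> y \<in> U"
  by (auto simp: joined_def)

lemma joined_refl: "joined U x x \<longleftrightarrow> x \<in> U"
  by (auto simp: joined_def)

lemma joined_edge: "x \<in> U \<Longrightarrow> y \<in> U \<Longrightarrow> (x, y) \<in> E \<Longrightarrow> joined U x y"
  by (auto simp: joined_def)

lemma joined_sym: "joined U x y \<Longrightarrow> joined U y x"
proof -
  have "sym ((E \<inter> U \<times> U)\<^sup>*)"
    using sym_E by (intro sym_rtrancl) (auto simp: sym_def)
  then show "joined U x y \<Longrightarrow> joined U y x"
    by (auto simp: joined_def sym_def)
qed

lemma joined_trans: "joined U x y \<Longrightarrow> joined U y z \<Longrightarrow> joined U x z"
  by (auto simp: joined_def)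

lemma joined_mono: "joined U x y \<Longrightarrow> U \<subseteq> W \<Longrightarrow> joined W x y"
proof -
  assume "U \<subseteq> W"
  then have "(E \<inter> U \<times> U)\<^sup>* \<subseteq> (E \<inter> W \<times> W)\<^sup>*"
    by (intro rtrancl_mono) auto
  then show "joined U x y \<Longrightarrow> U \<subseteq> W \<Longrightarrow> joined W x y"
    by (auto simp: joined_def)
qed

text \<open>By induction along the walk, which cannot leave \<open>H\<close>. Several connectivity
  arguments below reduce to the choice of a suitable closed set \<open>H\<close>.\<close>

lemma joined_closed:
  assumes "joined U x y" "x \<in> H" "\<And>a b. a \<in> H \<Longrightarrow> b \<in> U \<Longrightarrow> (a, b) \<in> E \<Longrightarrow> b \<in> H"
  shows "joined (H \<inter> U) x y"
proof -
  have xU: "x \<in> U" and "(x, y) \<in> (E \<inter> U \<times> U)\<^sup>*" using assms(1) by (auto simp: joined_def)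
  from this(2) show ?thesis
  proof (induction rule: rtrancl_induct)
    case base
    then show ?case using xU assms(2) by (simp add: joined_refl)
  next
    case (step y z)
    then have "y \<in> H \<inter> U" by (auto dest: joined_in)
    with step.hyps have "joined (H \<inter> U) y z" by (intro joined_edge) (auto intro: assms(3))
    with step.IH show ?case by (rule joined_trans)
  qed
qed

text \<open>A walk from \<open>u\<close> to \<open>p\<close> through \<open>v\<close> would join
  \<open>v\<close> to \<open>p\<close>. So the vertices joined to \<open>p\<close> form a closed set
  that avoids \<open>v\<close>.\<close>

lemma joined_remove_other: "joined W u p \<Longrightarrow> \<not> joined W v p \<Longrightarrow> joined (W - {v}) u p"
proof -
  assume u: "joined W u p" and v: "\<not> joined W v p"
  have "b \<in> {x. joined W x p}" if "a \<in> {x. joined W x p}" "b \<in> W" "(a, b) \<in> E" for a b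
  proof -
    have "joined W b a" using that sym_E by (intro joined_edge) (auto dest: joined_in simp: sym_def)
    then show ?thesis using that by (auto intro: joined_trans)
  qed
  then have "joined ({x. joined W x p} \<inter> W) u p" using u by (intro joined_closed) auto
  then show ?thesis by (rule joined_mono) (use v in auto)
qed

text \<open>Connectedness of \<open>H\<close> does not refer to \<open>U\<close>, so when the
  ambient set changes, only the edges leaving \<open>H\<close> have to be checked.\<close>

lemma components_iff:
  "H \<in> components U \<longleftrightarrow>
     H \<subseteq> U \<and> connected_set H \<and> (\<forall>a\<in>H. \<forall>b\<in>U. (a, b) \<in> E \<longrightarrow> b \<in> H)" (is "?L \<longleftrightarrow> ?R")
proof
  assume ?L
  then obtain x where x: "x \<in> U" and H: "H = component U x" by (auto simp: components_def)
  have closed: "b \<in> H" if "a \<in> H" "b \<in> U" "(a, b) \<in> E" for a b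
    using that unfolding H component_def by (auto intro: joined_trans joined_edge dest: joined_in)
  have "H \<subseteq> U" by (auto simp: H component_def dest: joined_in)
  moreover have xH: "x \<in> H" using x by (simp add: H component_def joined_refl)
  moreover have "joined H x y" if "y \<in> H" for y
  proof -
    have "joined (H \<inter> U) x y"
      using joined_closed[of U x y H] that xH closed by (auto simp: H component_def)
    then show ?thesis by (rule joined_mono) auto
  qed
  ultimately have "joined H a b" if "a \<in> H" "b \<in> H" for a b
    using that joined_trans[OF joined_sym] by blast
  then show ?R using closed \<open>H \<subseteq> U\<close> xH unfolding connected_set_def by blast
next
  assume R: ?R
  then obtain x where x: "x \<in> H" by (auto simp: connected_set_def)
  have "H = component U x"
  proof
    show "H \<subseteq> component U x"
      using R x joined_mono[of H x _ U] by (auto simp: component_def connected_set_def)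
    show "component U x \<subseteq> H"
      using joined_closed[of U x _ H] R x by (auto simp: component_def dest: joined_in)
  qed
  then show ?L using x R by (auto simp: components_def)
qed

lemma components_subset: "H \<in> components U \<Longrightarrow> H \<subseteq> U"
  and components_connected: "H \<in> components U \<Longrightarrow> connected_set H"
  and components_closed: "H \<in> components U \<Longrightarrow> a \<in> H \<Longrightarrow> b \<in> U \<Longrightarrow> (a, b) \<in> E \<Longrightarrow> b \<in> H"
  by (auto simp: components_iff)

lemma components_nonempty: "H \<in> components U \<Longrightarrow> H \<noteq> {}"
  using components_connected by (auto simp: connected_set_def)

lemma component_in_components: "x \<in> U \<Longrightarrow> component U x \<in> components U"
  by (simp add: components_def)

lemma mem_component: "x \<in> component U x \<longleftrightarrow> x \<in> U"
  by (simp add: component_def joined_refl)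

lemma connected_subset_component:
  assumes "connected_set W" "W \<subseteq> U" "H \<in> components U" "x \<in> W" "x \<in> H"
  shows "W \<subseteq> H"
proof
  fix y assume "y \<in> W"
  then have "joined U x y" using assms by (auto simp: connected_set_def intro: joined_mono)
  then have "joined (H \<inter> U) x y"
    using joined_closed[of U x y H] assms components_closed by auto
  then show "y \<in> H" by (auto dest: joined_in)
qed

lemma components_eqI: "H \<in> components U \<Longrightarrow> K \<in> components U \<Longrightarrow> x \<in> H \<Longrightarrow> x \<in> K \<Longrightarrow> H = K"
  using connected_subset_component[of H U K x] connected_subset_component[of K U H x]
    components_subset components_connected by blast

lemma components_disjoint: "H \<in> components U \<Longrightarrow> K \<in> components U \<Longrightarrow> H \<noteq> K \<Longrightarrow> H \<inter> K = {}"
  using components_eqI by blast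

lemma component_eqI: "H \<in> components U \<Longrightarrow> x \<in> H \<Longrightarrow> component U x = H"
  by (metis component_in_components components_eqI components_subset mem_component subsetD)

lemma Union_components: "\<Union> (components U) = U"
  using component_in_components mem_component components_subset by blast

lemma finite_components: "finite U \<Longrightarrow> finite (components U)"
  by (simp add: components_def)

lemma components_connected_set: "connected_set U \<Longrightarrow> components U = {U}"
proof -
  assume U: "connected_set U"
  then have "U \<in> components U" by (auto simp: components_iff)
  moreover have "H = U" if "H \<in> components U" for H
    using components_eqI[OF that \<open>U \<in> components U\<close>] components_nonempty[OF that]
      components_subset[OF that] by blast
  ultimately show ?thesis by blast
qed

lemma component_connected_set: "connected_set U \<Longrightarrow> v \<in> U \<Longrightarrow> component U v = U"
  using components_connected_set component_in_components by blast

lemma joined_component_iff: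
  assumes "H \<in> components U" "y \<in> H"
  shows "joined U x y \<longleftrightarrow> joined H x y"
proof
  assume "joined U x y"
  then have "joined (H \<inter> U) y x"
    using joined_closed[of U y x H] assms components_closed joined_sym by blast
  then show "joined H x y" by (auto intro: joined_sym joined_mono)
next
  assume "joined H x y"
  then show "joined U x y" using assms components_subset joined_mono by blast
qed

text \<open>No edge leads from \<open>v\<close> to a component other than its own, so only
  \<open>H0\<close> breaks up.\<close>

lemma components_remove:
  assumes "H0 \<in> components U" "v \<in> H0"
  shows "components (U - {v}) = components (H0 - {v}) \<union> (components U - {H0})" (is "?L = ?R")
proof
  show "?L \<subseteq> ?R"
  proof
    fix H assume H: "H \<in> ?L"
    then obtain x where x: "x \<in> H" using components_nonempty by blast
    have HU: "H \<subseteq> U" "v \<notin> H" using components_subset[OF H] by auto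
    have conn: "connected_set H" using H by (rule components_connected)
    show "H \<in> ?R"
    proof (cases "x \<in> H0")
      case True
      then have "H \<subseteq> H0" using connected_subset_component[OF conn HU(1) assms(1) x] by blast
      then have "H \<in> components (H0 - {v})"
        using H HU components_subset[OF assms(1)] by (auto simp: components_iff)
      then show ?thesis by blast
    next
      case False
      have dis: "H \<inter> H0 = {}"
        using connected_subset_component[OF conn HU(1) assms(1)] False x by blast
      have "b \<in> H" if "a \<in> H" "b \<in> U" "(a, b) \<in> E" for a b
      proof -
        have "b \<noteq> v"
        proof
          assume "b = v"
          then have "a \<in> H0"
            using components_closed[OF assms(1,2), of a] that HU sym_E by (auto simp: sym_def)
          then show False using dis that by blast
        qed
        then show ?thesis using H that by (auto simp: components_iff)
      qed
      then have "H \<in> components U" using conn HU by (auto simp: components_iff)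
      then show ?thesis using HU assms by blast
    qed
  qed
  show "?R \<subseteq> ?L"
  proof
    fix H assume "H \<in> ?R"
    then show "H \<in> ?L"
    proof
      assume H: "H \<in> components (H0 - {v})"
      have "b \<in> H" if "a \<in> H" "b \<in> U - {v}" "(a, b) \<in> E" for a b
        using that H components_subset[OF H] components_closed[OF assms(1), of a b]
          components_closed[OF H, of a b] by blast
      then show ?thesis using components_subset[OF H] components_subset[OF assms(1)]
          components_connected[OF H] unfolding components_iff[of H "U - {v}"] by blast
    next
      assume "H \<in> components U - {H0}"
      moreover from this have "v \<notin> H" using assms components_eqI by blast
      ultimately show ?thesis unfolding Diff_iff components_iff by blast
    qed
  qed
qed

lemma components_remove_subset:
  assumes "H0 \<in> components U" "v \<in> H0" "H \<in> components (H0 - {v})"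
  shows "H \<in> components (U - {v})"
  using components_remove assms by blast

lemma finite_component_member: "finite U \<Longrightarrow> H \<in> components U \<Longrightarrow> finite H"
  using components_subset finite_subset by blast

section \<open>Search trees and elimination orders\<close>

inductive stree :: "'a set \<Rightarrow> 'a rtree \<Rightarrow> bool" where
  stree_Node: "\<lbrakk>r \<in> U; \<And>H. H \<in> components (U - {r}) \<Longrightarrow> stree H (f H);
    fset ts = f ` components (U - {r})\<rbrakk> \<Longrightarrow> stree U (Node r ts)"

text \<open>Vertices outside \<open>U\<close> are skipped; the value is meaningless unless the list covers \<open>U\<close>.\<close>

primrec elim_tree :: "'a list \<Rightarrow> 'a set \<Rightarrow> 'a rtree" where
  "elim_tree [] U = undefined"
| "elim_tree (v # s) U =
    (if v \<in> U then Node v (Abs_fset (elim_tree s ` components (U - {v}))) else elim_tree s U)"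

lemma elim_tree_filter:
  "U \<subseteq> W \<Longrightarrow> elim_tree (filter (\<lambda>x. x \<in> W) s) U = elim_tree s U"
proof (induction s arbitrary: U)
  case (Cons v s)
  have "elim_tree (filter (\<lambda>x. x \<in> W) s) ` components (U - {v}) = elim_tree s ` components (U - {v})"
    using Cons.IH Cons.prems components_subset by (intro image_cong) blast+
  then show ?case using Cons by auto
qed simp

lemma tree_verts_stree: "stree U T \<Longrightarrow> tree_verts T = U"
proof (induction rule: stree.induct)
  case (stree_Node r U f ts)
  then have "\<Union> (tree_verts ` fset ts) = \<Union> (components (U - {r}))" by auto
  then show ?case using stree_Node.hyps by (auto simp: Union_components)
qed

lemma fset_Abs_fset: "finite A \<Longrightarrow> fset (Abs_fset A) = A"
  by (simp add: Abs_fset_inverse)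

lemma stree_elim_tree:
  "finite U \<Longrightarrow> U \<noteq> {} \<Longrightarrow> U \<subseteq> set s \<Longrightarrow> stree U (elim_tree s U)"
proof (induction s arbitrary: U)
  case (Cons v s)
  show ?case
  proof (cases "v \<in> U")
    case True
    have "stree U (Node v (Abs_fset (elim_tree s ` components (U - {v}))))"
    proof (rule stree_Node[OF True, of "elim_tree s"])
      fix H assume H: "H \<in> components (U - {v})"
      then show "stree H (elim_tree s H)"
        using Cons.IH[of H] Cons.prems components_subset[OF H] components_nonempty[OF H]
        by (auto intro: finite_subset)
    qed (use Cons.prems in \<open>simp add: fset_Abs_fset finite_components\<close>)
    then show ?thesis using True by simp
  next
    case False
    then show ?thesis using Cons by auto
  qed
qed simp

lemma elim_tree_root:
  assumes t: "\<And>H. H \<in> components (U - {r}) \<Longrightarrow> filter (\<lambda>x. x \<in> H) t = s H"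
    and f: "\<And>H. H \<in> components (U - {r}) \<Longrightarrow> f H = elim_tree (s H) H"
    and "r \<in> U" "finite U" "fset ts = f ` components (U - {r})"
  shows "elim_tree (r # t) U = Node r ts"
proof -
  have "elim_tree t H = f H" if "H \<in> components (U - {r})" for H
    using elim_tree_filter[of H H t] t[OF that] f[OF that] by simp
  then have "elim_tree t ` components (U - {r}) = fset ts" using assms(5) by simp
  then show ?thesis using assms(3) by (simp add: fset_inverse)
qed

text \<open>The root comes first, followed by any merging of orders for the children. The order is
  far from unique: every ordering of \<open>U\<close> in which ancestors precede descendants yields
  \<open>T\<close>.\<close>

lemma stree_obtain_elim_tree:
  assumes "stree U T" "finite U"
  shows "\<exists>s. distinct s \<and> set s = U \<and> T = elim_tree s U"
  using assms
proof (induction rule: stree.induct)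
  case (stree_Node r U f ts)
  let ?C = "components (U - {r})"
  have "\<forall>H\<in>?C. \<exists>s. distinct s \<and> set s = H \<and> f H = elim_tree s H"
    using stree_Node.IH stree_Node.prems finite_component_member[of "U - {r}"] by auto
  then obtain s where s: "\<And>H. H \<in> ?C \<Longrightarrow> distinct (s H) \<and> set (s H) = H \<and> f H = elim_tree (s H) H"
    by metis
  obtain t where t: "distinct t" "set t = \<Union> ?C" "\<And>H. H \<in> ?C \<Longrightarrow> filter (\<lambda>x. x \<in> H) t = s H"
    using merge_lists[of ?C s] s components_disjoint finite_components stree_Node.prems by auto
  have "elim_tree (r # t) U = Node r ts"
    using elim_tree_root[OF t(3), where f = f and ts = ts] s stree_Node by blast
  moreover have "distinct (r # t) \<and> set (r # t) = U"
    using t stree_Node.hyps by (auto simp: Union_components)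
  ultimately show ?case by metis
qed

section \<open>Tubes as a recursion over the elimination order\<close>

text \<open>One list processes all components at once, without branching. This gives a rule for
  appended lists, by which a change in the middle of an order can be isolated.\<close>

primrec elim_tubes :: "'a list \<Rightarrow> 'a set \<Rightarrow> 'a set set" where
  "elim_tubes [] U = {}"
| "elim_tubes (v # s) U =
    (if v \<in> U then insert (component U v) (elim_tubes s (U - {v})) else elim_tubes s U)"

text \<open>Removing \<open>v\<close> affects only the component of \<open>v\<close>, so the
  unbranched recursion agrees with the branching one of the tree.\<close>

lemma elim_tubes_components: "elim_tubes s U = (\<Union>H\<in>components U. elim_tubes s H)"
proof (induction s arbitrary: U)
  case (Cons v s)
  show ?case
  proof (cases "v \<in> U")
    case True
    define H0 where "H0 = component U v"
    have H0: "H0 \<in> components U" "v \<in> H0"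
      using True by (auto simp: H0_def component_in_components mem_component)
    have v: "v \<notin> H" if "H \<in> components U - {H0}" for H using that components_eqI H0 by blast
    have "elim_tubes (v # s) U = insert H0 (\<Union>H\<in>components (U - {v}). elim_tubes s H)"
      using True Cons.IH[of "U - {v}"] by (simp add: H0_def)
    also have "\<dots> = insert H0 (\<Union>H\<in>components (H0 - {v}). elim_tubes s H) \<union>
        (\<Union>H\<in>components U - {H0}. elim_tubes s H)"
      by (auto simp: components_remove[OF H0])
    also have "insert H0 (\<Union>H\<in>components (H0 - {v}). elim_tubes s H) = elim_tubes (v # s) H0"
      using Cons.IH[of "H0 - {v}"] H0 component_connected_set[OF components_connected[OF H0(1)]] by simp
    also have "(\<Union>H\<in>components U - {H0}. elim_tubes s H) =
        (\<Union>H\<in>components U - {H0}. elim_tubes (v # s) H)"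
      using v by simp
    also have "elim_tubes (v # s) H0 \<union> \<dots> = (\<Union>H\<in>components U. elim_tubes (v # s) H)"
      using H0 by blast
    finally show ?thesis .
  next
    case False
    then have "v \<notin> H" if "H \<in> components U" for H using that components_subset by blast
    then show ?thesis using False Cons.IH[of U] by simp
  qed
qed simp

lemma tubes_Node: "tubes (Node r ts) = insert (tree_verts (Node r ts)) (\<Union> (tubes ` fset ts))"
  by (auto simp: tubes_def)

lemma tubes_stree_Node:
  assumes "stree U (Node r ts)" "fset ts = f ` C"
  shows "tubes (Node r ts) = insert U (\<Union>H\<in>C. tubes (f H))"
  using tree_verts_stree[OF assms(1)] by (simp add: tubes_Node assms(2) del: rtree.set)

lemma tubes_elim_tree:
  "finite U \<Longrightarrow> connected_set U \<Longrightarrow> U \<subseteq> set s \<Longrightarrow> tubes (elim_tree s U) = elim_tubes s U"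
proof (induction s arbitrary: U)
  case Nil
  then show ?case by (simp add: connected_set_def)
next
  case (Cons v s)
  show ?case
  proof (cases "v \<in> U")
    case True
    have IH: "tubes (elim_tree s H) = elim_tubes s H" if "H \<in> components (U - {v})" for H
    proof (rule Cons.IH)
      show "finite H" using that Cons.prems finite_component_member[of "U - {v}"] by simp
      show "connected_set H" using that by (rule components_connected)
      show "H \<subseteq> set s" using components_subset[OF that] Cons.prems by auto
    qed
    let ?ts = "Abs_fset (elim_tree s ` components (U - {v}))"
    have "stree U (Node v ?ts)"
      using stree_elim_tree[of U "v # s"] Cons.prems True by (simp add: connected_set_def)
    then have "tubes (Node v ?ts) = insert U (\<Union>H\<in>components (U - {v}). tubes (elim_tree s H))"
      by (rule tubes_stree_Node) (use Cons.prems in \<open>simp add: fset_Abs_fset finite_components\<close>)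
    also have "\<dots> = insert U (elim_tubes s (U - {v}))"
      using IH by (simp add: elim_tubes_components[of s "U - {v}"])
    finally show ?thesis using True Cons.prems component_connected_set by simp
  next
    case False
    then show ?thesis using Cons by auto
  qed
qed

lemma tubes_subset: "stree U T \<Longrightarrow> K \<in> tubes T \<Longrightarrow> K \<subseteq> U"
proof (induction arbitrary: K rule: stree.induct)
  case (stree_Node r U f ts)
  have "tree_verts (Node r ts) = U"
    using stree_Node.hyps by (intro tree_verts_stree stree.stree_Node)
  then show ?case
    using stree_Node components_subset by (fastforce simp: tubes_Node simp del: rtree.set)
qed

lemma tubes_self: "stree U T \<Longrightarrow> U \<in> tubes T"
  using tree_verts_stree[of U T] by (cases T) (auto simp: tubes_Node simp del: rtree.set)

lemma tubes_nonempty: "K \<in> tubes (T :: 'a rtree) \<Longrightarrow> K \<noteq> {}"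
proof -
  have "tree_verts S \<noteq> {}" for S :: "'a rtree" by (cases S) simp
  then have "{} \<notin> tree_verts ` subtrees T" for T :: "'a rtree" by force
  then show "K \<in> tubes T \<Longrightarrow> K \<noteq> {}" for T :: "'a rtree" unfolding tubes_def by blast
qed

text \<open>Tubes are non-empty and components are disjoint, so no tube of one child lies inside the
  component of another. Thus the tubes of a child can be read off from the whole family.\<close>

lemma tubes_children:
  assumes "r \<in> U" and f: "\<forall>H\<in>components (U - {r}). stree H (f H)"
    and ts: "fset ts = f ` components (U - {r})"
  shows "tubes (Node r ts) = insert U (\<Union>H\<in>components (U - {r}). tubes (f H))"
    and "U \<notin> (\<Union>H\<in>components (U - {r}). tubes (f H))"
    and "\<Union> (\<Union>H\<in>components (U - {r}). tubes (f H)) = U - {r}"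
    and "\<And>H. H \<in> components (U - {r}) \<Longrightarrow> tubes (f H) = {K \<in> tubes (Node r ts). K \<subseteq> H}"
proof -
  let ?C = "components (U - {r})"
  show t: "tubes (Node r ts) = insert U (\<Union>H\<in>?C. tubes (f H))"
    using stree_Node[of r U f ts] assms by (intro tubes_stree_Node) auto
  have sub: "K \<subseteq> H" if "K \<in> tubes (f H)" "H \<in> ?C" for K H
    using that tubes_subset f by blast
  show "tubes (f H) = {K \<in> tubes (Node r ts). K \<subseteq> H}" if H: "H \<in> ?C" for H
  proof -
    have "K \<in> tubes (f H)" if "K \<in> tubes (f H')" "H' \<in> ?C" "K \<subseteq> H" for K H'
      using that H sub[OF that(1,2)] tubes_nonempty[OF that(1)] components_eqI[of H' _ H] by blast
    moreover have "\<not> U \<subseteq> H" using H components_subset assms(1) by blast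
    ultimately show ?thesis using H sub[OF _ H] t by blast
  qed
  show "U \<notin> (\<Union>H\<in>?C. tubes (f H))" using sub components_subset assms(1) by blast
  show "\<Union> (\<Union>H\<in>?C. tubes (f H)) = U - {r}"
  proof
    show "\<Union> (\<Union>H\<in>?C. tubes (f H)) \<subseteq> U - {r}" using sub components_subset by blast
    show "U - {r} \<subseteq> \<Union> (\<Union>H\<in>?C. tubes (f H))"
    proof
      fix x assume "x \<in> U - {r}"
      then obtain H where H: "H \<in> ?C" "x \<in> H" using Union_components[of "U - {r}"] by blast
      then have "H \<in> tubes (f H)" using tubes_self f by simp
      with H show "x \<in> \<Union> (\<Union>H\<in>?C. tubes (f H))" by (intro UnionI[of H] UN_I[of H])
    qed
  qed
qed

lemma stree_NodeE:
  assumes "stree U (Node r ts)"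
  obtains f where "r \<in> U" "\<forall>H\<in>components (U - {r}). stree H (f H)"
    "fset ts = f ` components (U - {r})"
  using assms by (cases rule: stree.cases) blast

text \<open>The tubes of the children cover everything except the root.\<close>

lemma tubes_root:
  assumes "stree U (Node r ts)"
  shows "U - \<Union> (tubes (Node r ts) - {U}) = {r}"
proof -
  obtain f where f: "r \<in> U" "\<forall>H\<in>components (U - {r}). stree H (f H)"
    "fset ts = f ` components (U - {r})" using assms by (rule stree_NodeE)
  have "tubes (Node r ts) - {U} = (\<Union>H\<in>components (U - {r}). tubes (f H))"
    using tubes_children(1,2)[OF f] by blast
  then show ?thesis using tubes_children(3)[OF f] f(1) by auto
qed

text \<open>The family determines the root, hence the components below it, and then the tubes of
  each child. Trees may thus be identified by comparing tubes, the only data in which rotations are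
  expressed.\<close>

lemma tubes_inject:
  "stree U S \<Longrightarrow> stree U T \<Longrightarrow> tubes S = tubes T \<Longrightarrow> S = T"
proof (induction arbitrary: T rule: stree.induct)
  case (stree_Node r U f ts)
  have S: "stree U (Node r ts)" using stree_Node.hyps by (intro stree.stree_Node)
  obtain q us where T: "T = Node q us" by (cases T)
  have "q = r" using tubes_root[OF S] tubes_root[of U q us] stree_Node.prems T by simp
  have "stree U (Node r us)" using stree_Node.prems T \<open>q = r\<close> by simp
  then obtain g where g: "r \<in> U" "\<forall>H\<in>components (U - {r}). stree H (g H)"
    "fset us = g ` components (U - {r})" by (rule stree_NodeE)
  have "f H = g H" if H: "H \<in> components (U - {r})" for H
  proof (rule stree_Node.IH[OF H g(2)[rule_format, OF H]])
    have "tubes (f H) = {K \<in> tubes (Node r ts). K \<subseteq> H}"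
      using stree_Node.hyps H by (intro tubes_children(4)) auto
    also have "\<dots> = tubes (g H)"
      using tubes_children(4)[OF g H] stree_Node.prems T \<open>q = r\<close> by simp
    finally show "tubes (f H) = tubes (g H)" .
  qed
  then have "fset ts = fset us" using g(3) stree_Node.hyps by (metis image_cong)
  then show ?case using T \<open>q = r\<close> by (simp add: fset_inject)
qed

section \<open>Rotations as adjacent transpositions\<close>

text \<open>Each vertex is the root of exactly one subtree. Equal cardinality prevents the family of
  one tree from being properly contained in that of another on the same set.\<close>

lemma card_tubes: "stree U T \<Longrightarrow> finite U \<Longrightarrow> card (tubes T) = card U \<and> finite (tubes T)"
proof (induction rule: stree.induct)
  case (stree_Node r U f ts)
  let ?C = "components (U - {r})"
  have f: "\<forall>H\<in>?C. stree H (f H)" using stree_Node.hyps by blast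
  note t = tubes_children[OF stree_Node.hyps(1) f stree_Node.hyps(3)]
  have fin: "finite ?C" using stree_Node.prems by (simp add: finite_components)
  have finH: "finite H" if "H \<in> ?C" for H
    using that stree_Node.prems finite_component_member[of "U - {r}"] by simp
  have IH: "card (tubes (f H)) = card H" "finite (tubes (f H))" if "H \<in> ?C" for H
    using stree_Node.IH[OF that finH[OF that]] by auto
  have "tubes (f H) \<inter> tubes (f K) = {}" if "H \<in> ?C" "K \<in> ?C" "H \<noteq> K" for H K
  proof -
    have "L \<subseteq> H \<inter> K \<and> L \<noteq> {}" if "L \<in> tubes (f H) \<inter> tubes (f K)" for L
      using that tubes_subset[of H "f H" L] tubes_subset[of K "f K" L] tubes_nonempty[of L "f H"]
        f \<open>H \<in> ?C\<close> \<open>K \<in> ?C\<close> by blast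
    then show ?thesis using components_disjoint[OF that] by blast
  qed
  then have "card (\<Union>H\<in>?C. tubes (f H)) = (\<Sum>H\<in>?C. card H)"
    using IH fin by (subst card_UN_disjoint) auto
  also have "\<dots> = card (\<Union> ?C)"
    using components_disjoint finH by (subst card_Union_disjoint) (auto simp: pairwise_def disjnt_def)
  also have "\<dots> = card U - 1" using stree_Node.hyps stree_Node.prems by (simp add: Union_components)
  finally have "card (\<Union>H\<in>?C. tubes (f H)) = card U - 1" .
  moreover have "finite (\<Union>H\<in>?C. tubes (f H))" using IH fin by blast
  moreover have "card U > 0" using stree_Node.hyps stree_Node.prems by (auto simp: card_gt_0_iff)
  ultimately show ?case using t(1,2) by simp
qed

lemma elim_tubes_append: "elim_tubes (a @ t) U = elim_tubes a U \<union> elim_tubes t (U - set a)"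
proof (induction a arbitrary: U)
  case (Cons v a)
  have "U - insert v (set a) = U - {v} - set a" by blast
  then show ?case using Cons by simp
qed simp

lemma elim_tubes_meet: "K \<in> elim_tubes s U \<Longrightarrow> K \<inter> set s \<noteq> {}"
  by (induction s arbitrary: U) (auto simp: mem_component split: if_splits)

lemma elim_tubes_subset: "K \<in> elim_tubes s U \<Longrightarrow> K \<subseteq> U"
proof (induction s arbitrary: U)
  case (Cons v s)
  then show ?case
    using components_subset[OF component_in_components, of v U] by (fastforce split: if_splits)
qed simp

lemma component_remove_other:
  assumes "u \<in> W" "v \<in> W" "\<not> joined W u v"
  shows "component (W - {u}) v = component W v"
proof (rule component_eqI)
  have "component W v \<noteq> component W u"
    using assms mem_component[of v W] by (auto simp: component_def)
  then have "component W v \<in> components W - {component W u}"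
    using assms by (simp add: component_in_components)
  then show "component W v \<in> components (W - {u})"
    using components_remove[of "component W u" W u] assms
    by (simp add: component_in_components mem_component)
qed (use assms in \<open>simp add: mem_component\<close>)

text \<open>Whichever of \<open>u\<close> and \<open>v\<close> goes first is removed from the same
  component \<open>K\<close>, and the entries of \<open>b\<close> see the same remaining set. Only
  the tube of the second one depends on the order. It is not in \<open>Z\<close>: it avoids
  \<open>set a\<close>, contains one of \<open>u\<close> and \<open>v\<close>, and misses the other,
  whereas \<open>K\<close> contains both.\<close>

lemma tubes_swap:
  assumes "finite U" "connected_set U" "U \<subseteq> set (a @ u # v # b)" "u \<noteq> v"
    and "joined (U - set a) u v"
  obtains Z where
    "tubes (elim_tree (a @ u # v # b) U) = insert (component (U - set a - {u}) v) Z"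
    "tubes (elim_tree (a @ v # u # b) U) = insert (component (U - set a - {v}) u) Z"
    "component (U - set a - {u}) v \<notin> Z" "component (U - set a - {v}) u \<notin> Z"
proof -
  define W where "W = U - set a"
  have in_W: "u \<in> W" "v \<in> W" using assms(5) by (auto simp: W_def dest: joined_in)
  define A B K Z where "A = component (W - {u}) v" and "B = component (W - {v}) u"
    and "K = component W u" and "Z = elim_tubes a U \<union> {K} \<union> elim_tubes b (W - {u, v})"
  have K: "component W v = K"
  proof (rule component_eqI)
    show "K \<in> components W" using in_W by (simp add: K_def component_in_components)
    show "v \<in> K" using assms(5) by (simp add: K_def W_def component_def)
  qed
  have uv: "W - {u} - {v} = W - {u, v}" "W - {v} - {u} = W - {u, v}" by auto
  have "tubes (elim_tree (a @ u # v # b) U) = elim_tubes (a @ u # v # b) U"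
    "tubes (elim_tree (a @ v # u # b) U) = elim_tubes (a @ v # u # b) U"
    using assms by (simp_all add: tubes_elim_tree insert_commute)
  then have t: "tubes (elim_tree (a @ u # v # b) U) = insert A Z"
    "tubes (elim_tree (a @ v # u # b) U) = insert B Z"
    using in_W assms(4) K unfolding elim_tubes_append W_def[symmetric] Z_def
    by (auto simp: K_def A_def B_def uv)
  have AB: "v \<in> A" "A \<subseteq> W - {u}" "u \<in> B" "B \<subseteq> W - {v}"
    using in_W assms(4) components_subset[OF component_in_components, of v "W - {u}"]
      components_subset[OF component_in_components, of u "W - {v}"]
    by (auto simp: A_def B_def mem_component)
  have "L \<notin> elim_tubes a U" if "L \<subseteq> W" for L
    using elim_tubes_meet[of L a U] that by (auto simp: W_def)
  moreover have "L \<notin> elim_tubes b (W - {u, v})" if "u \<in> L \<or> v \<in> L" for L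
    using elim_tubes_subset[of L b "W - {u, v}"] that by auto
  moreover have "u \<in> K" "v \<in> K" using K in_W mem_component[of v W] by (auto simp: K_def mem_component)
  ultimately have "A \<notin> Z" "B \<notin> Z" using AB unfolding Z_def by blast+
  then show ?thesis using that t by (simp add: A_def B_def W_def)
qed

definition rotation :: "'a rtree \<Rightarrow> 'a rtree \<Rightarrow> bool" where
  "rotation S T \<longleftrightarrow> card (sym_diff (tubes S) (tubes T)) = 2"

lemma rotation_sym: "rotation S T \<Longrightarrow> rotation T S"
  by (simp add: rotation_def Un_commute)

lemma swap_eq_or_rotation:
  assumes "finite U" "connected_set U" "U \<subseteq> set (a @ u # v # b)" "u \<noteq> v"
  shows "elim_tree (a @ u # v # b) U = elim_tree (a @ v # u # b) U \<or>
    rotation (elim_tree (a @ u # v # b) U) (elim_tree (a @ v # u # b) U)"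
proof (cases "joined (U - set a) u v")
  case True
  define A B where "A = component (U - set a - {u}) v" and "B = component (U - set a - {v}) u"
  obtain Z where Z: "tubes (elim_tree (a @ u # v # b) U) = insert A Z"
    "tubes (elim_tree (a @ v # u # b) U) = insert B Z" "A \<notin> Z" "B \<notin> Z"
    using tubes_swap[OF assms True] by (metis A_def B_def)
  have "u \<in> B" "u \<notin> A"
    using joined_in[OF True] components_subset[OF component_in_components, of v "U - set a - {u}"]
      assms(4) by (auto simp: A_def B_def mem_component)
  then have "sym_diff (insert A Z) (insert B Z) = {A, B}" "A \<noteq> B" using Z by auto
  then show ?thesis by (simp add: rotation_def Z(1,2))
next
  \<comment> \<open>In different components the two removals do not interact, so the trees
    coincide.\<close>
  case False
  define W where "W = U - set a"
  have uv: "W - {u} - {v} = W - {u, v}" "W - {v} - {u} = W - {u, v}" by auto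
  have "elim_tubes (u # v # b) W = elim_tubes (v # u # b) W"
  proof (cases "u \<in> W \<and> v \<in> W")
    case True
    then have "component (W - {u}) v = component W v" "component (W - {v}) u = component W u"
      using False component_remove_other[of u W v] component_remove_other[of v W u]
        joined_sym[of W v u] unfolding W_def by blast+
    then show ?thesis using True assms(4) by (auto simp: uv)
  next
    case False
    then show ?thesis by auto
  qed
  then have "elim_tubes (a @ u # v # b) U = elim_tubes (a @ v # u # b) U"
    by (simp only: elim_tubes_append W_def)
  then have "tubes (elim_tree (a @ u # v # b) U) = tubes (elim_tree (a @ v # u # b) U)"
    using assms by (simp add: tubes_elim_tree insert_commute)
  moreover have "stree U (elim_tree (a @ u # v # b) U)" "stree U (elim_tree (a @ v # u # b) U)"
    using assms by (auto intro!: stree_elim_tree simp: connected_set_def)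
  ultimately show ?thesis using tubes_inject by blast
qed

text \<open>Children on the same component have equally many tubes, so where they differ, each has a
  tube that the other lacks. These two exhaust the symmetric difference, and all other children
  agree.\<close>

lemma rotation_same_rootE:
  assumes f: "r \<in> U" "\<forall>H\<in>components (U - {r}). stree H (f H)" "fset ts = f ` components (U - {r})"
    and g: "\<forall>H\<in>components (U - {r}). stree H (g H)" "fset us = g ` components (U - {r})"
    and "finite U" "rotation (Node r ts) (Node r us)"
  obtains H where "H \<in> components (U - {r})" "rotation (f H) (g H)"
    "\<And>K. K \<in> components (U - {r}) \<Longrightarrow> K \<noteq> H \<Longrightarrow> f K = g K"
proof -
  let ?C = "components (U - {r})" and ?D = "sym_diff (tubes (Node r ts)) (tubes (Node r us))"
  have finH: "finite H" if "H \<in> ?C" for H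
    using that assms finite_component_member[of "U - {r}"] by simp
  note tf = tubes_children[OF f] and tg = tubes_children[OF f(1) g]
  have card: "card ?D = 2" using assms(7) by (simp add: rotation_def)
  have local: "sym_diff (tubes (f H)) (tubes (g H)) = {K \<in> ?D. K \<subseteq> H}" if "H \<in> ?C" for H
    using tf(4)[OF that] tg(4)[OF that] by auto
  have "\<exists>H\<in>?C. tubes (f H) \<noteq> tubes (g H)"
  proof (rule ccontr)
    assume "\<not> ?thesis"
    then have "tubes (Node r ts) = tubes (Node r us)" by (simp add: tf(1) tg(1))
    then show False using card by simp
  qed
  then obtain H where H: "H \<in> ?C" "tubes (f H) \<noteq> tubes (g H)" by blast
  have "card (tubes (f H)) = card (tubes (g H))" "finite (tubes (f H))" "finite (tubes (g H))"
    using card_tubes f(2) g(1) H(1) finH by auto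
  then have "\<not> tubes (f H) \<subseteq> tubes (g H)" "\<not> tubes (g H) \<subseteq> tubes (f H)"
    using H(2) card_subset_eq by metis+
  then obtain A B where AB: "A \<in> tubes (f H) - tubes (g H)" "B \<in> tubes (g H) - tubes (f H)" by blast
  then have AB_D: "A \<in> ?D" "B \<in> ?D" "A \<subseteq> H" "B \<subseteq> H" "A \<noteq> B" using local[OF H(1)] by auto
  have D: "?D = {A, B}"
    using AB_D card by (intro card_two_eq)
  have "sym_diff (tubes (f H)) (tubes (g H)) = {A, B}"
    unfolding local[OF H(1)] D using AB_D by blast
  then have rot: "rotation (f H) (g H)" using AB_D by (simp add: rotation_def)
  have "f K = g K" if K: "K \<in> ?C" "K \<noteq> H" for K
  proof -
    have "\<not> A \<subseteq> K" "\<not> B \<subseteq> K"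
      using components_disjoint[OF K(1) H(1) K(2)] AB_D AB tubes_nonempty by fast+
    then have "sym_diff (tubes (f K)) (tubes (g K)) = {}" unfolding local[OF K(1)] D by blast
    then have "tubes (f K) = tubes (g K)" by blast
    then show ?thesis using tubes_inject[of K] f(2) g(1) K(1) by blast
  qed
  then show ?thesis using that H(1) rot by blast
qed

lemma elim_tree_Node_root:
  assumes "elim_tree s U = Node r ts" "set s = U" "U \<noteq> {}"
  shows "\<exists>t. s = r # t"
  using assms by (cases s) auto

text \<open>This lets an arbitrary rotation be studied through elimination orders. With equal roots
  the swap is inherited from a child; otherwise the two roots are exchanged at the very beginning of
  the order.\<close>

lemma rotation_imp_swap:
  assumes "stree U S" "stree U T" "rotation S T" "finite U" "connected_set U"
  shows "\<exists>a u v b. distinct (a @ u # v # b) \<and> set (a @ u # v # b) = U \<and>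
    S = elim_tree (a @ u # v # b) U \<and> T = elim_tree (a @ v # u # b) U"
  using assms
proof (induction arbitrary: T rule: stree.induct)
  case (stree_Node r U f ts)
  let ?C = "components (U - {r})"
  let ?S = "Node r ts"
  have f: "r \<in> U" "\<forall>H\<in>?C. stree H (f H)" "fset ts = f ` ?C" using stree_Node.hyps by auto
  have S: "stree U ?S" using stree.stree_Node[of r U f] f by blast
  have fin: "finite ?C" using stree_Node.prems by (simp add: finite_components)
  have finH: "finite H" if "H \<in> ?C" for H
    using that stree_Node.prems finite_component_member[of "U - {r}"] by simp
  obtain q us where T: "T = Node q us" by (cases T)
  obtain g where g: "q \<in> U" "\<forall>H\<in>components (U - {q}). stree H (g H)"
    "fset us = g ` components (U - {q})"
    using stree_Node.prems(1) unfolding T by (rule stree_NodeE)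
  obtain s where s: "\<And>H. H \<in> ?C \<Longrightarrow> distinct (s H) \<and> set (s H) = H \<and> f H = elim_tree (s H) H"
  proof -
    have "\<forall>H\<in>?C. \<exists>s. distinct s \<and> set s = H \<and> f H = elim_tree s H"
      using f(2) finH stree_obtain_elim_tree by blast
    then show ?thesis using that by metis
  qed
  \<comment> \<open>The orders of all components but \<open>H\<close> are merged into one tail, in
    front of which the order on \<open>H\<close> can be chosen freely.\<close>
  have rest: "\<exists>t. distinct t \<and> set t = \<Union> (?C - {H}) \<and>
      (\<forall>K\<in>?C - {H}. filter (\<lambda>x. x \<in> K) t = s K)" for H
    using fin s components_disjoint by (intro merge_lists) (simp_all, blast)
  have disj: "H \<inter> \<Union> (?C - {H}) = {}" if "H \<in> ?C" for H
    using that components_disjoint[of H "U - {r}"] by blast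
  have filt: "filter (\<lambda>x. x \<in> K) (w @ t) = (if K = H then w else s K)"
    if "K \<in> ?C" "H \<in> ?C" "set w = H" "set t = \<Union> (?C - {H})"
      "\<forall>K\<in>?C - {H}. filter (\<lambda>x. x \<in> K) t = s K" for w t H K
  proof (cases "K = H")
    case True
    have "filter (\<lambda>x. x \<in> H) t = []"
      using that disj[of H] unfolding filter_empty_conv by blast
    moreover have "filter (\<lambda>x. x \<in> H) w = w" using that by (intro filter_True) simp
    ultimately show ?thesis using True by simp
  next
    case False
    then have "filter (\<lambda>x. x \<in> K) w = []"
      using that components_disjoint[of H _ K] unfolding filter_empty_conv by blast
    then show ?thesis using False that by simp
  qed
  have order: "elim_tree (r # w @ t) U = Node r ts'"
    if H: "H \<in> ?C" "set w = H" and t: "set t = \<Union> (?C - {H})"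
      "\<forall>K\<in>?C - {H}. filter (\<lambda>x. x \<in> K) t = s K"
      and e: "\<And>K. K \<in> ?C \<Longrightarrow> K \<noteq> H \<Longrightarrow> e K = f K" "e H = elim_tree w H" "fset ts' = e ` ?C"
    for w t H e ts'
  proof (rule elim_tree_root[where f = e and s = "\<lambda>K. if K = H then w else s K"])
    fix K assume K: "K \<in> ?C"
    show "filter (\<lambda>x. x \<in> K) (w @ t) = (if K = H then w else s K)" by (rule filt[OF K H t])
    show "e K = elim_tree (if K = H then w else s K) K" using e(1)[OF K] e(2) s[OF K] by simp
  qed (use f(1) e(3) stree_Node.prems(3) in simp_all)
  have union: "H \<union> \<Union> (?C - {H}) = U - {r}" if "H \<in> ?C" for H
    using that Union_components[of "U - {r}"] by blast
  have perm: "distinct (r # w @ t) \<and> set (r # w @ t) = U"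
    if "H \<in> ?C" "set w = H" "distinct w" "distinct t" "set t = \<Union> (?C - {H})" for w t H
  proof -
    have "set (w @ t) = U - {r}" using that union[of H] by simp
    moreover have "distinct (w @ t)" using that disj[of H] by simp
    ultimately show ?thesis using f(1) by auto
  qed
  show ?case
  proof (cases "q = r")
    case True
    have g: "\<forall>H\<in>?C. stree H (g H)" "fset us = g ` ?C" using g True by auto
    have "rotation (Node r ts) (Node r us)" using stree_Node.prems T True by simp
    then obtain H where H: "H \<in> ?C" "rotation (f H) (g H)"
      "\<And>K. K \<in> ?C \<Longrightarrow> K \<noteq> H \<Longrightarrow> f K = g K"
      using rotation_same_rootE[OF f g stree_Node.prems(3)] by metis
    obtain a u v b where ab: "distinct (a @ u # v # b)" "set (a @ u # v # b) = H"
      "f H = elim_tree (a @ u # v # b) H" "g H = elim_tree (a @ v # u # b) H"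
      using stree_Node.IH[OF H(1) _ H(2) finH[OF H(1)] components_connected[OF H(1)]] g H(1) by metis
    obtain t where t: "distinct t" "set t = \<Union> (?C - {H})"
      "\<forall>K\<in>?C - {H}. filter (\<lambda>x. x \<in> K) t = s K" using rest[of H] by blast
    have ab': "set (a @ v # u # b) = H" using ab(2) by auto
    have "elim_tree (r # (a @ u # v # b) @ t) U = Node r ts"
      by (rule order[OF H(1) ab(2) t(2,3) refl ab(3) f(3)])
    moreover have "elim_tree (r # (a @ v # u # b) @ t) U = Node r us"
      by (rule order[OF H(1) ab' t(2,3) _ ab(4) g(2)]) (use H(3) in simp)
    moreover have "distinct (r # (a @ u # v # b) @ t)" "set (r # (a @ u # v # b) @ t) = U"
      using perm[OF H(1) ab(2,1) t(1,2)] by simp_all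
    ultimately have "distinct ((r # a) @ u # v # (b @ t)) \<and> set ((r # a) @ u # v # (b @ t)) = U \<and>
        ?S = elim_tree ((r # a) @ u # v # (b @ t)) U \<and> T = elim_tree ((r # a) @ v # u # (b @ t)) U"
      using T True by simp
    then show ?thesis by blast
  next
    case False
    define A B where "A = component (U - {r}) q" and "B = component (U - {q}) r"
    have A: "A \<in> ?C" "q \<in> A" and B: "B \<in> components (U - {q})" "r \<in> B"
      using False f(1) g(1) by (auto simp: A_def B_def component_in_components mem_component)
    note tS = tubes_children[OF f] and tT = tubes_children[OF g]
    \<comment> \<open>The root lies in no tube except the full set. Hence \<open>A\<close> and
      \<open>B\<close> each belong to one tree only, and they make up the whole symmetric
      difference.\<close>
    have T_q: "K = U" if "K \<in> tubes T" "q \<in> K" for K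
      using that tT(1,3) unfolding T by blast
    have S_r: "K = U" if "K \<in> tubes ?S" "r \<in> K" for K
      using that tS(1,3) by blast
    have AU: "A \<noteq> U" and BU: "B \<noteq> U" using components_subset A B f(1) g(1) by blast+
    have AS: "A \<in> tubes ?S" "A \<notin> tubes T"
      using tS(4)[OF A(1)] tubes_self[of A "f A"] f(2) A T_q AU by blast+
    have BT: "B \<in> tubes T" "B \<notin> tubes ?S"
      using tT(4)[OF B(1)] tubes_self[of B "g B"] g(2) B T S_r BU by blast+
    have "card (sym_diff (tubes ?S) (tubes T)) = 2"
      using stree_Node.prems by (simp add: rotation_def)
    then have D: "sym_diff (tubes ?S) (tubes T) = {A, B}"
      using AS BT by (intro card_two_eq) auto
    obtain z vs where z: "f A = Node z vs" by (cases "f A")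
    have "stree A (Node z vs)" using f(2) A(1) z by auto
    then obtain h where h: "z \<in> A" "\<forall>H\<in>components (A - {z}). stree H (h H)"
      "fset vs = h ` components (A - {z})" by (rule stree_NodeE)
    \<comment> \<open>Otherwise the subtree below \<open>z\<close> that contains \<open>q\<close>
      has a vertex set \<open>L\<close> that is a third element of the symmetric difference.\<close>
    have "z = q"
    proof (rule ccontr)
      assume "z \<noteq> q"
      define L where "L = component (A - {z}) q"
      have L: "L \<in> components (A - {z})" "q \<in> L"
        using A \<open>z \<noteq> q\<close> by (auto simp: L_def component_in_components mem_component)
      have "L \<in> tubes (f A)"
        using tubes_children(4)[OF h L(1)] tubes_self[of L "h L"] h(2) L(1) z by auto
      then have "L \<in> tubes ?S" using tS(4)[OF A(1)] by blast
      moreover have "L \<subseteq> A - {z}" using L(1) by (rule components_subset)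
      moreover have "L \<notin> tubes T"
        using T_q[OF _ L(2)] \<open>L \<subseteq> A - {z}\<close> components_subset[OF A(1)] f(1) by blast
      ultimately show False using D BT(2) h(1) by blast
    qed
    obtain t where t: "distinct t" "set t = \<Union> (?C - {A})"
      "\<forall>K\<in>?C - {A}. filter (\<lambda>x. x \<in> K) t = s K" using rest[of A] by blast
    have sA: "distinct (s A)" "set (s A) = A" "f A = elim_tree (s A) A" using s[OF A(1)] by auto
    then obtain w where w: "s A = q # w" using elim_tree_Node_root[of "s A" A q vs] z \<open>z = q\<close> A(2) by auto
    have S_eq: "elim_tree ([] @ r # q # (w @ t)) U = ?S"
    proof -
      have "elim_tree (r # (s A @ t)) U = Node r ts"
        by (rule order[OF A(1) sA(2) t(2,3) refl sA(3) f(3)])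
      then show ?thesis by (simp add: w)
    qed
    have dist: "distinct (r # q # (w @ t))" "set (r # q # (w @ t)) = U"
      using perm[OF A(1) sA(2,1) t(1,2)] unfolding w by simp_all
    have "joined (U - set []) r q" using stree_Node.prems(4) f(1) g(1) by (simp add: connected_set_def)
    then obtain Z where Z: "tubes (elim_tree ([] @ r # q # (w @ t)) U) = insert A Z"
      "tubes (elim_tree ([] @ q # r # (w @ t)) U) = insert B Z" "A \<notin> Z" "B \<notin> Z"
      using tubes_swap[of U "[]" r q "w @ t"] stree_Node.prems(3,4) dist False
      by (metis A_def B_def Diff_empty append_Nil equalityE list.set(1))
    have tS': "tubes ?S = insert A Z" using Z(1) S_eq by simp
    \<comment> \<open>Nothing is known about the lower part of \<open>T\<close>; it is recovered
      from the symmetric difference alone.\<close>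
    have "tubes T = insert B Z" by (rule sym_diff_exchange[OF D[unfolded tS'] AS(2) BT(1) Z(3)])
    then have "tubes T = tubes (elim_tree ([] @ q # r # (w @ t)) U)" using Z(2) by simp
    moreover have "stree U (elim_tree ([] @ q # r # (w @ t)) U)"
      using dist stree_Node.prems(3) f(1) by (intro stree_elim_tree) auto
    ultimately have "T = elim_tree ([] @ q # r # (w @ t)) U"
      using tubes_inject[OF stree_Node.prems(1)] by blast
    then show ?thesis using dist S_eq by (metis append_Nil)
  qed
qed

section \<open>Ancestors\<close>

text \<open>For connected \<open>U\<close> covered by \<open>s\<close> and \<open>p\<close> in
  \<open>U\<close>, these are the ancestors of \<open>p\<close> in the tree of \<open>s\<close>,
  from the root down to \<open>p\<close> itself: an ancestor is a vertex that is joined to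
  \<open>p\<close> when it is removed. Once \<open>p\<close> is gone, nothing is joined to
  it.\<close>

primrec ancestors :: "'a list \<Rightarrow> 'a set \<Rightarrow> 'a \<Rightarrow> 'a list" where
  "ancestors [] U p = []"
| "ancestors (v # s) U p = (if joined U v p then [v] else []) @ ancestors s (U - {v}) p"

lemma ancestors_append: "ancestors (a @ t) U p = ancestors a U p @ ancestors t (U - set a) p"
proof (induction a arbitrary: U)
  case (Cons v a)
  have "U - insert v (set a) = U - {v} - set a" by blast
  then show ?case using Cons by simp
qed simp

lemma ancestors_outside: "p \<notin> U \<Longrightarrow> ancestors s U p = []"
  by (induction s arbitrary: U) (auto dest: joined_in)

text \<open>Removals outside the component of \<open>p\<close> are invisible from
  \<open>p\<close>.\<close>

lemma ancestors_component:
  assumes "H \<in> components W" "p \<in> H"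
  shows "ancestors s W p = ancestors s H p"
  using assms
proof (induction s arbitrary: W H)
  case (Cons v s)
  have "joined W v p \<longleftrightarrow> joined H v p" using Cons.prems by (rule joined_component_iff)
  moreover have "ancestors s (W - {v}) p = ancestors s (H - {v}) p"
  proof (cases "v = p")
    case True
    then show ?thesis by (simp add: ancestors_outside)
  next
    case False
    have p: "p \<in> H - {v}" using False Cons.prems by simp
    define K where "K = component (H - {v}) p"
    have K: "K \<in> components (H - {v})" "p \<in> K"
      using p by (auto simp: K_def component_in_components mem_component)
    have "K \<in> components (W - {v})"
    proof (cases "v \<in> H")
      case True
      then show ?thesis using components_remove_subset Cons.prems K by blast
    next
      case False
      then have "K = H" using K components_connected_set components_connected[OF Cons.prems(1)] by auto
      then show ?thesis using False Cons.prems(1) by (auto simp: components_iff)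
    qed
    then show ?thesis using Cons.IH[of K "W - {v}"] Cons.IH[of K "H - {v}"] K by simp
  qed
  ultimately show ?case by simp
qed simp

lemma ancestors_filter: "U \<subseteq> W \<Longrightarrow> ancestors (filter (\<lambda>x. x \<in> W) s) U p = ancestors s U p"
proof (induction s arbitrary: U)
  case (Cons v s)
  show ?case
  proof (cases "v \<in> W")
    case True
    then show ?thesis using Cons.IH[of "U - {v}"] Cons.prems by auto
  next
    case False
    then have "v \<notin> U" using Cons.prems by blast
    then show ?thesis using False Cons by (auto dest: joined_in)
  qed
qed simp

text \<open>This allows a new elimination order, suited to the next rotation, to be chosen at every
  tree of a walk. The first relevant entries are the common root, and the recursion follows the
  child containing \<open>p\<close>.\<close>

lemma ancestors_cong:
  "\<lbrakk>finite U; U \<subseteq> set s; U \<subseteq> set t; elim_tree s U = elim_tree t U; connected_set U; p \<in> U\<rbrakk>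
    \<Longrightarrow> ancestors s U p = ancestors t U p"
proof (induction U arbitrary: s t rule: finite_psubset_induct)
  case (psubset U)
  define s' t' where "s' = filter (\<lambda>x. x \<in> U) s" and "t' = filter (\<lambda>x. x \<in> U) t"
  have st: "set s' = U" "set t' = U" "elim_tree s' U = elim_tree t' U"
    using psubset.prems by (auto simp: s'_def t'_def elim_tree_filter)
  obtain v s'' where s'': "s' = v # s''" using st(1) psubset.prems by (cases s') auto
  obtain v' t'' where t'': "t' = v' # t''" using st(2) psubset.prems by (cases t') auto
  have v: "v \<in> U" "v' \<in> U" using st s'' t'' by auto
  then have "v' = v" using st(3) by (simp add: s'' t'')
  let ?C = "components (U - {v})"
  have fin: "finite ?C" using psubset.hyps by (simp add: finite_components)
  have "Abs_fset (elim_tree s'' ` ?C) = Abs_fset (elim_tree t'' ` ?C)"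
    using st(3) v by (simp add: s'' t'' \<open>v' = v\<close>)
  then have img: "elim_tree s'' ` ?C = elim_tree t'' ` ?C"
    using fin by (metis finite_imageI fset_Abs_fset)
  have "ancestors s'' (U - {v}) p = ancestors t'' (U - {v}) p"
  proof (cases "p = v")
    case True
    then show ?thesis by (simp add: ancestors_outside)
  next
    case False
    define H where "H = component (U - {v}) p"
    have H: "H \<in> ?C" "p \<in> H"
      using False psubset.prems by (auto simp: H_def component_in_components mem_component)
    have sub: "K \<subseteq> U - {v}" "K \<noteq> {}" "K \<subseteq> set s''" "K \<subseteq> set t''" "finite K" if "K \<in> ?C" for K
      using components_subset[OF that] components_nonempty[OF that] st(1,2) psubset.hyps
      unfolding s'' t'' \<open>v' = v\<close> by (auto intro: finite_subset)
    \<comment> \<open>The children agree only as a set, so the partner of the tree on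
      \<open>H\<close> has to be identified by its vertex set.\<close>
    obtain K where K: "K \<in> ?C" "elim_tree s'' H = elim_tree t'' K" using img H(1) by blast
    have "H = tree_verts (elim_tree s'' H)"
      using tree_verts_stree[OF stree_elim_tree] sub[OF H(1)] by metis
    also have "\<dots> = K" using tree_verts_stree[OF stree_elim_tree] sub[OF K(1)] K(2) by metis
    finally have "elim_tree s'' H = elim_tree t'' H" using K by simp
    then have "ancestors s'' H p = ancestors t'' H p"
      using psubset.IH[of H s'' t''] sub[OF H(1)] H v(1) components_connected[OF H(1)] by blast
    then show ?thesis using ancestors_component[OF H] by simp
  qed
  then have "ancestors s' U p = ancestors t' U p" by (simp add: s'' t'' \<open>v' = v\<close>)
  then show ?case by (simp add: s'_def t'_def ancestors_filter)
qed

section \<open>The upper bound\<close>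

text \<open>Reflexive, so that walks can be padded to any greater length.\<close>

definition flip :: "'a set \<Rightarrow> 'a rtree rel" where
  "flip U = {(S, T). S = T \<or> stree U S \<and> stree U T \<and> rotation S T}"

lemma Id_flip: "Id \<subseteq> flip U"
  by (auto simp: flip_def)

lemma sym_flip: "sym (flip U)"
  by (auto simp: flip_def sym_def rotation_sym)

definition diameter_le :: "'a set \<Rightarrow> nat \<Rightarrow> bool" where
  "diameter_le U d \<longleftrightarrow> (\<forall>S T. stree U S \<longrightarrow> stree U T \<longrightarrow> (S, T) \<in> flip U ^^ d)"

lemma diameter_le_mono: "diameter_le U d \<Longrightarrow> d \<le> e \<Longrightarrow> diameter_le U e"
  using relpow_mono_exponent[OF Id_flip] unfolding diameter_le_def by blast

lemma flip_swap:
  assumes "finite U" "connected_set U" "U \<subseteq> set (a @ u # v # b)" "u \<noteq> v"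
  shows "(elim_tree (a @ u # v # b) U, elim_tree (a @ v # u # b) U) \<in> flip U"
proof -
  have "stree U (elim_tree (a @ u # v # b) U)" "stree U (elim_tree (a @ v # u # b) U)"
    using assms by (auto intro!: stree_elim_tree simp: connected_set_def)
  then show ?thesis using swap_eq_or_rotation[OF assms] by (auto simp: flip_def)
qed

text \<open>\<open>r\<close> passes the entries of \<open>a\<close> one at a time, starting with the
  last.\<close>

lemma flips_move_front:
  assumes "finite U" "connected_set U" "U \<subseteq> set (a @ r # b)" "r \<notin> set a"
  shows "(elim_tree (a @ r # b) U, elim_tree (r # a @ b) U) \<in> flip U ^^ length a"
  using assms
proof (induction a arbitrary: b rule: rev_induct)
  case (snoc x a)
  have "(elim_tree (a @ x # r # b) U, elim_tree (a @ r # x # b) U) \<in> flip U"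
    using snoc.prems by (intro flip_swap) auto
  moreover have "(elim_tree (a @ r # x # b) U, elim_tree (r # a @ x # b) U) \<in> flip U ^^ length a"
    using snoc.prems by (intro snoc.IH) auto
  ultimately show ?case using relpow_Suc_I2 by fastforce
qed simp

section \<open>Grafting search trees below a common root\<close>

text \<open>The children are given by a function on components, so that one child can be replaced by
  a function update.\<close>

definition graft :: "'a \<Rightarrow> 'a set \<Rightarrow> ('a set \<Rightarrow> 'a rtree) \<Rightarrow> 'a rtree" where
  "graft r U f = Node r (Abs_fset (f ` components (U - {r})))"

lemma stree_graft:
  assumes "finite U" "r \<in> U" "\<forall>H\<in>components (U - {r}). stree H (f H)"
  shows "stree U (graft r U f)"
    and "tubes (graft r U f) = insert U (\<Union>H\<in>components (U - {r}). tubes (f H))"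
proof -
  have ts: "fset (Abs_fset (f ` components (U - {r}))) = f ` components (U - {r})"
    using assms(1) by (simp add: fset_Abs_fset finite_components)
  then show "stree U (graft r U f)"
    using stree_Node[of r U f] assms unfolding graft_def by blast
  show "tubes (graft r U f) = insert U (\<Union>H\<in>components (U - {r}). tubes (f H))"
    using tubes_children(1)[OF assms(2,3) ts] by (simp add: graft_def)
qed

text \<open>\<open>U\<close> and the tubes of the other children occur in both trees and are not
  tubes of the changed child, so the symmetric difference is the one on \<open>H\<close>.\<close>

lemma flip_graft:
  assumes "finite U" "r \<in> U" "\<forall>H\<in>components (U - {r}). stree H (f H)"
    and H: "H \<in> components (U - {r})" and "(f H, T) \<in> flip H"
  shows "(graft r U f, graft r U (f(H := T))) \<in> flip U"
proof (cases "T = f H")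
  case True
  then show ?thesis by (simp add: flip_def fun_upd_idem)
next
  case False
  then have T: "stree H T" "rotation (f H) T" using assms(5) by (auto simp: flip_def)
  let ?C = "components (U - {r})" and ?f = "f(H := T)"
  have f': "\<forall>K\<in>?C. stree K (?f K)" using assms(3) T by simp
  define X where "X = insert U (\<Union>K\<in>?C - {H}. tubes (f K))"
  have "tubes (graft r U f) = X \<union> tubes (f H)"
    using stree_graft(2)[OF assms(1-3)] H unfolding X_def by blast
  moreover have "tubes (graft r U ?f) = X \<union> tubes T"
  proof -
    have "(\<Union>K\<in>?C. tubes (?f K)) = (\<Union>K\<in>?C - {H}. tubes (f K)) \<union> tubes T"
      using H by (auto split: if_splits)
    then show ?thesis unfolding X_def stree_graft(2)[OF assms(1,2) f'] by (simp only: Un_insert_left)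
  qed
  moreover have "L \<notin> X" if "L \<in> tubes (f H) \<union> tubes T" for L
  proof -
    have L: "L \<subseteq> H" "L \<noteq> {}"
      using that tubes_subset[of H] assms(3) H T(1) tubes_nonempty by blast+
    have "L \<notin> tubes (f K)" if "K \<in> ?C - {H}" for K
      using L components_disjoint[of K _ H] tubes_subset[of K "f K" L] assms(3) H that by blast
    moreover have "L \<noteq> U" using L components_subset[OF H] assms(2) by blast
    ultimately show ?thesis unfolding X_def by blast
  qed
  ultimately have "sym_diff (tubes (graft r U f)) (tubes (graft r U ?f)) =
      sym_diff (tubes (f H)) (tubes T)" by auto
  then have "rotation (graft r U f) (graft r U ?f)" using T(2) by (simp add: rotation_def)
  then show ?thesis using stree_graft(1)[OF assms(1,2)] assms(3) f' by (simp add: flip_def)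
qed

lemma flips_graft_one:
  assumes "finite U" "r \<in> U" "\<forall>H\<in>components (U - {r}). stree H (f H)"
    and H: "H \<in> components (U - {r})" and "(f H, T) \<in> flip H ^^ d"
  shows "(graft r U f, graft r U (f(H := T))) \<in> flip U ^^ d"
  using assms(3,5)
proof (induction d arbitrary: f)
  case (Suc d)
  from Suc.prems(2) obtain S where S: "(f H, S) \<in> flip H" "(S, T) \<in> flip H ^^ d"
    by (rule relpow_Suc_E2)
  have "stree H S" using S(1) Suc.prems(1) H by (auto simp: flip_def)
  then have "(graft r U (f(H := S)), graft r U (f(H := S, H := T))) \<in> flip U ^^ d"
    using Suc.prems S by (intro Suc.IH) auto
  then show ?case
    using flip_graft[OF assms(1,2) Suc.prems(1) H S(1)] relpow_Suc_I2
    by (metis fun_upd_upd)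
qed (simp add: fun_upd_idem)

lemma flips_graft:
  assumes "finite U" "r \<in> U" "\<forall>H\<in>components (U - {r}). stree H (f H)"
    and g: "\<forall>H\<in>components (U - {r}). stree H (g H)"
    and d: "\<forall>H\<in>components (U - {r}). diameter_le H (d H)"
  shows "(graft r U f, graft r U g) \<in> flip U ^^ (\<Sum>H\<in>components (U - {r}). d H)"
proof -
  \<comment> \<open>\<open>?m B\<close> is the intermediate state in which exactly the children on
    \<open>B\<close> have been transformed.\<close>
  let ?C = "components (U - {r})" and ?m = "\<lambda>B H. if H \<in> B then g H else f H"
  have "finite ?C" using assms(1) by (simp add: finite_components)
  moreover have "B \<subseteq> ?C \<Longrightarrow> (graft r U f, graft r U (?m B)) \<in> flip U ^^ (\<Sum>H\<in>B. d H)"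
    if "finite B" for B
    using that
  proof (induction B rule: finite_induct)
    case (insert K B)
    have "(graft r U (?m B), graft r U ((?m B)(K := g K))) \<in> flip U ^^ d K"
      using insert assms by (intro flips_graft_one) (auto simp: diameter_le_def)
    moreover have "(?m B)(K := g K) = ?m (insert K B)" by auto
    ultimately have "(graft r U f, graft r U (?m (insert K B))) \<in> flip U ^^ ((\<Sum>H\<in>B. d H) + d K)"
      using insert relpow_trans by auto
    then show ?case using insert by (simp add: add.commute)
  qed simp
  ultimately have "(graft r U f, graft r U (?m ?C)) \<in> flip U ^^ (\<Sum>H\<in>?C. d H)" by blast
  moreover have "?m ?C ` ?C = g ` ?C" by (intro image_cong) auto
  then have "graft r U (?m ?C) = graft r U g" unfolding graft_def by simp
  ultimately show ?thesis by simp
qed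

lemma flips_to_root:
  assumes "finite U" "connected_set U" "r \<in> U" "stree U S"
  obtains f where "\<forall>H\<in>components (U - {r}). stree H (f H)" "(S, graft r U f) \<in> flip U ^^ card U"
proof -
  obtain s where s: "distinct s" "set s = U" "S = elim_tree s U"
    using stree_obtain_elim_tree assms by blast
  then obtain a b where ab: "s = a @ r # b" "r \<notin> set a" using assms(3) by (metis split_list_first)
  define f where "f = elim_tree (a @ b)"
  have "(S, elim_tree (r # a @ b) U) \<in> flip U ^^ length a"
    using flips_move_front[of U a r b] assms s ab by simp
  moreover have "elim_tree (r # a @ b) U = graft r U f" using assms(3) by (simp add: graft_def f_def)
  moreover have "length a \<le> card U" using s ab distinct_card[of s] by simp
  ultimately have "(S, graft r U f) \<in> flip U ^^ card U"
    using relpow_mono_exponent[OF Id_flip] by simp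
  moreover have "stree H (f H)" if "H \<in> components (U - {r})" for H
    unfolding f_def using assms(1) that components_subset[OF that] components_nonempty[OF that] s ab
    by (intro stree_elim_tree) (auto intro: finite_subset)
  ultimately show ?thesis using that by blast
qed

text \<open>The factor 2 accounts for the two trees; the walk from the second one is traversed
  backwards.\<close>

lemma diameter_le_remove:
  assumes "finite U" "connected_set U" "r \<in> U"
    and d: "\<forall>H\<in>components (U - {r}). diameter_le H (d H)"
  shows "diameter_le U (2 * card U + (\<Sum>H\<in>components (U - {r}). d H))"
  unfolding diameter_le_def
proof (intro allI impI)
  fix S T assume S: "stree U S" and T: "stree U T"
  obtain f where f: "\<forall>H\<in>components (U - {r}). stree H (f H)" "(S, graft r U f) \<in> flip U ^^ card U"
    using flips_to_root assms(1-3) S by blast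
  obtain g where g: "\<forall>H\<in>components (U - {r}). stree H (g H)" "(T, graft r U g) \<in> flip U ^^ card U"
    using flips_to_root assms(1-3) T by blast
  have "(graft r U g, T) \<in> flip U ^^ card U" using relpow_symI[OF sym_flip g(2)] .
  with f(2) flips_graft[OF assms(1,3) f(1) g(1) d]
  have "(S, T) \<in> flip U ^^ (card U + (\<Sum>H\<in>components (U - {r}). d H) + card U)"
    by (blast intro: relpow_trans)
  then show "(S, T) \<in> flip U ^^ (2 * card U + (\<Sum>H\<in>components (U - {r}). d H))"
    by (simp add: mult_2 add_ac)
qed

section \<open>Separators and interval representations\<close>

lemma sum_card_components: "finite U \<Longrightarrow> (\<Sum>H\<in>components U. card H) = card U"
  using card_Union_disjoint[of "components U"] components_disjoint[of _ U] finite_component_member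
  by (simp add: Union_components pairwise_def disjnt_def)

lemma components_Diff_subset:
  assumes "H \<in> components (U - {r})" "r \<in> X"
  shows "components (H - X) \<subseteq> components (U - X)"
proof
  fix K assume K: "K \<in> components (H - X)"
  have "b \<in> K" if "a \<in> K" "b \<in> U - X" "(a, b) \<in> E" for a b
  proof -
    have "a \<in> H" using that components_subset[OF K] by blast
    then have "b \<in> H" using components_closed[OF assms(1), of a b] that assms(2) by blast
    then show ?thesis using components_closed[OF K] that by blast
  qed
  then show "K \<in> components (U - X)"
    using components_subset[OF K] components_subset[OF assms(1)] components_connected[OF K]
    unfolding components_iff[of K "U - X"] by blast
qed

text \<open>The vertices of \<open>X\<close> are removed one by one. A bound linear in the
  cardinality survives summation over disjoint components, so each removal adds 2 to the factor, and
  the pieces left in the end are components of \<open>U - X\<close>.\<close>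

lemma diameter_le_separator:
  assumes "finite U" "connected_set U" "card (X \<inter> U) \<le> s"
    and "\<forall>H\<in>components (U - X). diameter_le H (c * card H)"
  shows "diameter_le U ((2 * s + c) * card U)"
  using assms
proof (induction s arbitrary: U)
  case 0
  then have "U - X = U" by auto
  then show ?case using 0 components_connected_set by simp
next
  case (Suc s)
  show ?case
  proof (cases "X \<inter> U = {}")
    case True
    then have "U - X = U" by auto
    then have "diameter_le U (c * card U)" using Suc components_connected_set by simp
    then show ?thesis by (rule diameter_le_mono) (intro mult_le_mono1, simp)
  next
    case False
    then obtain r where r: "r \<in> X" "r \<in> U" by blast
    let ?C = "components (U - {r})"
    have "diameter_le H ((2 * s + c) * card H)" if H: "H \<in> ?C" for H
    proof (rule Suc.IH)
      show "finite H" using H Suc.prems(1) finite_component_member[of "U - {r}"] by simp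
      show "connected_set H" using H by (rule components_connected)
      have "X \<inter> H \<subseteq> X \<inter> U - {r}" using components_subset[OF H] by blast
      then have "card (X \<inter> H) \<le> card (X \<inter> U - {r})" using Suc.prems(1) by (intro card_mono) auto
      also have "\<dots> \<le> s" using Suc.prems(1,3) r by simp
      finally show "card (X \<inter> H) \<le> s" .
      show "\<forall>K\<in>components (H - X). diameter_le K (c * card K)"
        using components_Diff_subset[OF H r(1)] Suc.prems(4) by blast
    qed
    then have "diameter_le U (2 * card U + (\<Sum>H\<in>?C. (2 * s + c) * card H))"
      using diameter_le_remove[of U r "\<lambda>H. (2 * s + c) * card H"] Suc.prems(1,2) r by blast
    moreover have "(\<Sum>H\<in>?C. (2 * s + c) * card H) \<le> (2 * s + c) * card U"
      using sum_card_components[of "U - {r}"] Suc.prems(1) r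
      by (simp flip: sum_distrib_left add: mult_le_mono)
    then have "2 * card U + (\<Sum>H\<in>?C. (2 * s + c) * card H) \<le> (2 * Suc s + c) * card U"
      by (simp add: algebra_simps)
    ultimately show ?thesis by (rule diameter_le_mono)
  qed
qed

text \<open>The separator consists of the intervals through a median of the right end points.\<close>

lemma interval_separator:
  fixes l r :: "'a \<Rightarrow> real"
  assumes "finite U" "U \<noteq> {}" "\<And>v. v \<in> U \<Longrightarrow> l v \<le> r v"
    and edge: "\<And>u v. u \<in> U \<Longrightarrow> v \<in> U \<Longrightarrow> (u, v) \<in> E \<Longrightarrow> {l u..r u} \<inter> {l v..r v} \<noteq> {}"
  obtains x where "\<forall>H\<in>components (U - {v. l v \<le> x \<and> x \<le> r v}). 2 * card H \<le> card U"
proof -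
  \<comment> \<open>\<open>x\<close> will be the least right end point by which at least half of the
    intervals have ended. Its minimality bounds \<open>L\<close>, and its membership in
    \<open>P\<close> bounds \<open>R\<close>.\<close>
  define P where "P = {x \<in> r ` U. card U \<le> 2 * card {v \<in> U. r v \<le> x}}"
  have "finite P" using assms(1) by (simp add: P_def)
  have "{v \<in> U. r v \<le> Max (r ` U)} = U" using assms(1) by auto
  then have "Max (r ` U) \<in> P" using assms(1,2) by (simp add: P_def)
  define x where "x = Min P"
  have x: "x \<in> P" "\<And>y. y \<in> P \<Longrightarrow> x \<le> y"
    unfolding x_def using \<open>finite P\<close> \<open>Max (r ` U) \<in> P\<close> by (intro Min_in Min_le; blast)+
  define L where "L = {v \<in> U. r v < x}"
  define R where "R = {v \<in> U. x < l v}"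
  have L: "2 * card L \<le> card U"
  proof (cases "L = {}")
    case False
    have "finite L" using assms(1) by (simp add: L_def)
    define y where "y = Max (r ` L)"
    have y: "y \<in> r ` L" "\<And>v. v \<in> L \<Longrightarrow> r v \<le> y"
      using False \<open>finite L\<close> Max_in[of "r ` L"] by (auto simp: y_def)
    have "y < x" using y(1) by (auto simp: L_def)
    then have "y \<notin> P" using x(2)[of y] by auto
    moreover have "y \<in> r ` U" using y(1) by (auto simp: L_def)
    ultimately have "2 * card {v \<in> U. r v \<le> y} < card U" by (simp add: P_def)
    moreover have "L \<subseteq> {v \<in> U. r v \<le> y}" using y(2) by (auto simp: L_def)
    then have "card L \<le> card {v \<in> U. r v \<le> y}" using assms(1) by (intro card_mono) auto
    ultimately show ?thesis by simp
  qed simp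
  have R: "2 * card R \<le> card U"
  proof -
    have "R \<subseteq> U - {v \<in> U. r v \<le> x}" using assms(3) by (fastforce simp: R_def)
    then have "card R \<le> card (U - {v \<in> U. r v \<le> x})" using assms(1) by (intro card_mono) auto
    also have "\<dots> = card U - card {v \<in> U. r v \<le> x}" using assms(1) by (intro card_Diff_subset) auto
    finally show ?thesis using x(1) by (auto simp: P_def)
  qed
  have "2 * card H \<le> card U" if H: "H \<in> components (U - {v. l v \<le> x \<and> x \<le> r v})" for H
  proof -
    let ?W = "U - {v. l v \<le> x \<and> x \<le> r v}"
    have HW: "H \<subseteq> ?W" using components_subset[OF H] .
    have W: "?W = L \<union> R" by (auto simp: L_def R_def)
    have LR: "L \<inter> R = {}" using assms(3) by (fastforce simp: L_def R_def)
    \<comment> \<open>An interval ending before \<open>x\<close> cannot meet one that starts after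
      \<open>x\<close>.\<close>
    have no_edge: "b \<in> L" if "a \<in> L" "b \<in> ?W" "(a, b) \<in> E" for a b
    proof (rule ccontr)
      assume "b \<notin> L"
      then have "b \<in> R" using that(2) W by blast
      then have "{l a..r a} \<inter> {l b..r b} = {}" using that(1) by (auto simp: L_def R_def)
      then show False using edge[of a b] that by (auto simp: L_def)
    qed
    have "H \<subseteq> L \<or> H \<subseteq> R"
    proof (cases "H \<inter> L = {}")
      case True
      then show ?thesis using HW W by blast
    next
      case False
      then obtain a where a: "a \<in> H" "a \<in> L" by blast
      have "H \<subseteq> L"
      proof
        fix b assume "b \<in> H"
        then have "joined H a b"
          using components_connected[OF H] a by (simp add: connected_set_def)
        then have "joined (L \<inter> H) a b" using joined_closed[of H a b L] a no_edge HW by blast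
        then show "b \<in> L" by (auto dest: joined_in)
      qed
      then show ?thesis ..
    qed
    moreover have "finite L" "finite R" using assms(1) by (simp_all add: L_def R_def)
    ultimately have "card H \<le> card L \<or> card H \<le> card R" by (meson card_mono)
    then show ?thesis using L R by linarith
  qed
  then show ?thesis using that by blast
qed

text \<open>\<open>j\<close> counts halvings, and each level adds \<open>2 * k\<close> per vertex,
  the price of a separator of at most \<open>k\<close> vertices. For \<open>j = 0\<close> there is
  no non-empty set.\<close>

lemma diameter_le_interval:
  fixes l r :: "'a \<Rightarrow> real"
  assumes "\<And>v. v \<in> V \<Longrightarrow> l v \<le> r v"
    and "\<And>u v. u \<in> V \<Longrightarrow> v \<in> V \<Longrightarrow> (u, v) \<in> E \<Longrightarrow> {l u..r u} \<inter> {l v..r v} \<noteq> {}"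
    and clique: "\<And>x. card {v \<in> V. l v \<le> x \<and> x \<le> r v} \<le> k"
    and "finite V" "U \<subseteq> V" "connected_set U" "card U < 2 ^ j"
  shows "diameter_le U (2 * k * j * card U)"
  using assms(5-7)
proof (induction j arbitrary: U)
  case 0
  then show ?case using assms(4) finite_subset[of U V] by (auto simp: connected_set_def)
next
  case (Suc j)
  have U: "finite U" "U \<noteq> {}" using Suc.prems assms(4) finite_subset by (auto simp: connected_set_def)
  obtain x where x: "\<forall>H\<in>components (U - {v. l v \<le> x \<and> x \<le> r v}). 2 * card H \<le> card U"
    using interval_separator[of U l r] U assms(1,2) Suc.prems(1) by blast
  let ?X = "{v. l v \<le> x \<and> x \<le> r v}"
  have "card (?X \<inter> U) \<le> card {v \<in> V. l v \<le> x \<and> x \<le> r v}"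
    using Suc.prems(1) assms(4) by (intro card_mono) auto
  then have "card (?X \<inter> U) \<le> k" using clique[of x] by linarith
  moreover have "diameter_le H (2 * k * j * card H)" if H: "H \<in> components (U - ?X)" for H
  proof (rule Suc.IH)
    show "H \<subseteq> V" using components_subset[OF H] Suc.prems(1) by blast
    show "connected_set H" using H by (rule components_connected)
    show "card H < 2 ^ j" using x H Suc.prems(3) by fastforce
  qed
  ultimately have "diameter_le U ((2 * k + 2 * k * j) * card U)"
    using U(1) Suc.prems(2) by (intro diameter_le_separator) auto
  then show ?case by (simp add: algebra_simps)
qed

end

section \<open>Alternations\<close>

fun alternations :: "bool list \<Rightarrow> nat" where
  "alternations (x # y # zs) = (if x \<noteq> y then 1 else 0) + alternations (y # zs)"
| "alternations _ = 0"

lemma alternations_Cons_ge: "alternations xs \<le> alternations (x # xs)"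
  by (cases xs) auto

lemma alternations_Cons_le: "alternations (x # xs) \<le> alternations xs + 1"
  by (cases xs) auto

text \<open>The new entry takes part in at most two comparisons.\<close>

lemma alternations_insert_le: "alternations (a @ x # c) \<le> alternations (a @ c) + 2"
proof (induction a rule: alternations.induct)
  case ("2_2" v)
  show ?case by (cases c) auto
qed (use alternations_Cons_le[of x c] in auto)

text \<open>If the neighbours of the deleted entry differ from each other, one of them differs from
  that entry.\<close>

lemma alternations_delete_le: "alternations (a @ c) \<le> alternations (a @ x # c)"
proof (induction a rule: alternations.induct)
  case ("2_2" v)
  show ?case by (cases c) auto
qed (use alternations_Cons_ge[of c x] in auto)

lemma alternations_insert_list_le: "alternations (a @ y @ c) \<le> alternations (a @ c) + 2 * length y"
proof (induction y)
  case (Cons x y)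
  then show ?case using alternations_insert_le[of a x "y @ c"] by simp
qed simp

lemma alternations_delete_list_le: "alternations (a @ c) \<le> alternations (a @ y @ c)"
proof (induction y)
  case (Cons x y)
  then show ?case using alternations_delete_le[of a "y @ c" x] by simp
qed simp

lemma alternations_duplicate: "alternations (a @ x # x # c) = alternations (a @ x # c)"
  by (induction a rule: alternations.induct) auto

lemma alternations_append_ge: "alternations xs \<le> alternations (xs @ ys)"
  using alternations_delete_list_le[of xs "[]" ys] by simp

lemma alternations_const: "\<forall>x\<in>set xs. x = c \<Longrightarrow> alternations xs = 0"
  by (induction xs rule: alternations.induct) auto

text \<open>Only the alternations inside the pairs are counted; those between consecutive pairs
  would no more than double the bound.\<close>

lemma alternations_pairs:
  "\<forall>x\<in>set xs. f x \<and> \<not> g x \<Longrightarrow> length xs \<le> alternations (concat (map (\<lambda>x. [f x, g x]) xs))"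
proof (induction xs)
  case (Cons x xs)
  then show ?case
    using alternations_Cons_ge[of "concat (map (\<lambda>x. [f x, g x]) xs)" "g x"] by simp
qed simp

text \<open>The dyadic interval \<open>{i..<i + 2 ^ Suc j}\<close> is represented by its left end point \<open>i\<close>; the
  list \<open>w i\<close> will be the list of ancestors of \<open>i\<close>.\<close>

definition sides :: "nat \<Rightarrow> nat \<Rightarrow> nat list \<Rightarrow> bool list" where
  "sides j i xs = map (\<lambda>x. x < i + 2 ^ j) (filter (\<lambda>x. x \<in> {i..<i + 2 ^ Suc j}) xs)"

lemma sides_append: "sides j i (xs @ ys) = sides j i xs @ sides j i ys"
  by (simp add: sides_def)

lemma length_sides_le: "length (sides j i xs) \<le> length xs"
  by (simp add: sides_def)

text \<open>The sum runs over the dyadic intervals of length at least two inside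
  \<open>{i..<i + 2 ^ j}\<close>; a single point has no halves.\<close>

primrec potential :: "nat \<Rightarrow> nat \<Rightarrow> (nat \<Rightarrow> nat list) \<Rightarrow> nat" where
  "potential 0 i w = 0"
| "potential (Suc j) i w =
    alternations (sides j i (w i)) + potential j i w + potential j (i + 2 ^ j) w"

lemma potential_cong:
  "(\<And>p. p < i + 2 ^ j \<Longrightarrow> w p = w' p) \<Longrightarrow> potential j i w = potential j i w'"
proof (induction j arbitrary: i)
  case (Suc j)
  have "potential j i w = potential j i w'" by (rule Suc.IH) (use Suc.prems in simp)
  moreover have "potential j (i + 2 ^ j) w = potential j (i + 2 ^ j) w'"
    by (rule Suc.IH) (use Suc.prems in \<open>simp add: add.assoc\<close>)
  moreover have "w i = w' i" by (rule Suc.prems) simp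
  ultimately show ?case by simp
qed simp

text \<open>Two vertices are separated by the midpoint of at most one dyadic interval containing both of
  them, so exchanging them affects a single summand of the potential.\<close>

lemma potential_exchange:
  assumes "\<And>j i. i + 2 ^ Suc j \<le> N \<Longrightarrow>
      alternations (sides j i (w' i)) \<le> alternations (sides j i (w i)) + 4"
    and "\<And>j i. i + 2 ^ Suc j \<le> N \<Longrightarrow>
      u \<notin> {i..<i + 2 ^ Suc j} \<or> v \<notin> {i..<i + 2 ^ Suc j} \<or> (u < i + 2 ^ j \<longleftrightarrow> v < i + 2 ^ j) \<Longrightarrow>
      alternations (sides j i (w' i)) \<le> alternations (sides j i (w i))"
    and "i + 2 ^ j \<le> N"
  shows "potential j i w' \<le> potential j i w + 4"
    and "u \<notin> {i..<i + 2 ^ j} \<or> v \<notin> {i..<i + 2 ^ j} \<Longrightarrow> potential j i w' \<le> potential j i w"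
proof -
  have "potential j i w' \<le> potential j i w + 4 \<and>
    (u \<notin> {i..<i + 2 ^ j} \<or> v \<notin> {i..<i + 2 ^ j} \<longrightarrow> potential j i w' \<le> potential j i w)"
    using assms(3)
  proof (induction j arbitrary: i)
    case (Suc j)
    let ?l = "{i..<i + 2 ^ j}" and ?r = "{i + 2 ^ j..<i + 2 ^ j + 2 ^ j}"
    let ?I = "{i..<i + 2 ^ Suc j}"
    have I: "?I = ?l \<union> ?r" by auto
    have l: "potential j i w' \<le> potential j i w + 4"
      "u \<notin> ?l \<or> v \<notin> ?l \<Longrightarrow> potential j i w' \<le> potential j i w"
      using Suc.IH[of i] Suc.prems by auto
    have r: "potential j (i + 2 ^ j) w' \<le> potential j (i + 2 ^ j) w + 4"
      "u \<notin> ?r \<or> v \<notin> ?r \<Longrightarrow> potential j (i + 2 ^ j) w' \<le> potential j (i + 2 ^ j) w"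
      using Suc.IH[of "i + 2 ^ j"] Suc.prems by auto
    note a = assms(1)[OF Suc.prems] assms(2)[OF Suc.prems]
    consider "u \<notin> ?I \<or> v \<notin> ?I" | "u \<in> ?l" "v \<in> ?l" | "u \<in> ?r" "v \<in> ?r"
      | "u \<in> ?l" "v \<in> ?r" | "u \<in> ?r" "v \<in> ?l"
      unfolding I by blast
    then show ?case
    proof cases
      case 1
      then have "u \<notin> ?l \<or> v \<notin> ?l" "u \<notin> ?r \<or> v \<notin> ?r" unfolding I by blast+
      then show ?thesis using l(2) r(2) a(2)[OF 1[THEN disjE]] 1 a(2) by auto
    next
      case 2
      then have "u \<notin> ?r" "u \<in> ?I" "v \<in> ?I" "u < i + 2 ^ j \<longleftrightarrow> v < i + 2 ^ j" by auto
      then show ?thesis using l(1) r(2) a(2) by fastforce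
    next
      case 3
      then have "u \<notin> ?l" "u \<in> ?I" "v \<in> ?I" "u < i + 2 ^ j \<longleftrightarrow> v < i + 2 ^ j" by auto
      then show ?thesis using l(2) r(1) a(2) by fastforce
    next
      case 4
      then have "v \<notin> ?l" "u \<notin> ?r" "u \<in> ?I" "v \<in> ?I" by auto
      then show ?thesis using l(2) r(2) a(1) by fastforce
    next
      case 5
      then have "u \<notin> ?l" "v \<notin> ?r" "u \<in> ?I" "v \<in> ?I" by auto
      then show ?thesis using l(2) r(2) a(1) by fastforce
    qed
  qed simp
  then show "potential j i w' \<le> potential j i w + 4"
    and "u \<notin> {i..<i + 2 ^ j} \<or> v \<notin> {i..<i + 2 ^ j} \<Longrightarrow> potential j i w' \<le> potential j i w"
    by blast+
qed

section \<open>The bit-reversal order\<close>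

text \<open>The highest bit changes fastest: the list alternates between the two halves at every
  step, and its restriction to either half is again a bit-reversal list, up to a shift. So it
  alternates as often as possible at all scales simultaneously.\<close>

primrec bit_reversal :: "nat \<Rightarrow> nat list" where
  "bit_reversal 0 = [0]"
| "bit_reversal (Suc j) = concat (map (\<lambda>x. [x, x + 2 ^ j]) (bit_reversal j))"

lemma bit_reversal_less: "x \<in> set (bit_reversal j) \<Longrightarrow> x < 2 ^ j"
  by (induction j arbitrary: x) fastforce+

lemma length_bit_reversal: "length (bit_reversal j) = 2 ^ j"
  by (induction j) (simp_all add: length_concat comp_def sum_list_triv)

lemma filter_bit_reversal:
  "filter (\<lambda>x. x < 2 ^ j) (bit_reversal (Suc j)) = bit_reversal j"
  "filter (\<lambda>x. 2 ^ j \<le> x) (bit_reversal (Suc j)) = map (\<lambda>x. x + 2 ^ j) (bit_reversal j)"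
proof -
  have "\<forall>x\<in>set xs. x < 2 ^ j \<Longrightarrow> filter (\<lambda>x. x < 2 ^ j) (concat (map (\<lambda>x. [x, x + 2 ^ j]) xs)) = xs \<and>
    filter (\<lambda>x. 2 ^ j \<le> x) (concat (map (\<lambda>x. [x, x + 2 ^ j]) xs)) = map (\<lambda>x. x + 2 ^ j) xs" for xs :: "nat list"
    by (induction xs) auto
  from this[of "bit_reversal j"] bit_reversal_less
  show "filter (\<lambda>x. x < 2 ^ j) (bit_reversal (Suc j)) = bit_reversal j"
    "filter (\<lambda>x. 2 ^ j \<le> x) (bit_reversal (Suc j)) = map (\<lambda>x. x + 2 ^ j) (bit_reversal j)" by auto
qed

lemma distinct_bit_reversal: "distinct (bit_reversal j)"
proof (induction j)
  case (Suc j)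
  let ?f = "filter (\<lambda>x. x < 2 ^ j) (bit_reversal (Suc j))"
  let ?g = "filter (\<lambda>x. \<not> x < 2 ^ j) (bit_reversal (Suc j))"
  have "?g = map (\<lambda>x. x + 2 ^ j) (bit_reversal j)"
    using filter_bit_reversal(2)[of j] by (simp add: not_less del: bit_reversal.simps)
  then have "distinct ?f" "distinct ?g"
    using Suc filter_bit_reversal(1)[of j] by (simp_all add: distinct_map inj_on_def del: bit_reversal.simps)
  moreover have "mset (bit_reversal (Suc j)) = mset ?f + mset ?g"
    by (simp add: mset_filter del: bit_reversal.simps)
  then have "distinct (bit_reversal (Suc j)) = distinct (?f @ ?g)"
    by (metis mset_append mset_eq_imp_distinct_iff)
  ultimately show ?case by (auto simp del: bit_reversal.simps)
qed simp

text \<open>Here \<open>q\<close> and \<open>j\<close> refer to positions among the odd vertices.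
  Passing from \<open>j\<close> to \<open>j + 1\<close>, the top interval contributes at least
  \<open>2 ^ j\<close> alternations and each half at least \<open>j * 2 ^ j / 2\<close>, which adds
  up to \<open>(j + 1) * 2 ^ j\<close>. Intervals of length two contain only one odd vertex and are
  given up; hence \<open>Suc j\<close> in the potential.\<close>

lemma potential_bit_reversal:
  assumes w: "\<And>q. q < 2 ^ m \<Longrightarrow> \<exists>t. w (2 * q) = map (\<lambda>x. 2 * x + 1) (bit_reversal m) @ t"
    and "q + 2 ^ j \<le> 2 ^ m"
    and "filter (\<lambda>x. x \<in> {q..<q + 2 ^ j}) (bit_reversal m) = map (\<lambda>x. q + x) (bit_reversal j)"
  shows "j * 2 ^ j \<le> 2 * potential (Suc j) (2 * q) w"
  using assms(2,3)
proof (induction j arbitrary: q)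
  case (Suc j)
  let ?B = "bit_reversal m"
  have "filter (\<lambda>x. x \<in> {q..<q + 2 ^ j}) ?B
      = filter (\<lambda>x. x < q + 2 ^ j) (filter (\<lambda>x. x \<in> {q..<q + 2 ^ Suc j}) ?B)"
    unfolding filter_filter by (rule filter_cong) auto
  also have "\<dots> = map (\<lambda>x. q + x) (filter (\<lambda>x. x < 2 ^ j) (bit_reversal (Suc j)))"
    unfolding Suc.prems(2) filter_map by (simp add: comp_def del: bit_reversal.simps)
  finally have l: "j * 2 ^ j \<le> 2 * potential (Suc j) (2 * q) w"
    using Suc.prems(1) by (intro Suc.IH) (simp_all add: filter_bit_reversal del: bit_reversal.simps)
  have "filter (\<lambda>x. x \<in> {q + 2 ^ j..<q + 2 ^ j + 2 ^ j}) ?B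
      = filter (\<lambda>x. q + 2 ^ j \<le> x) (filter (\<lambda>x. x \<in> {q..<q + 2 ^ Suc j}) ?B)"
    unfolding filter_filter by (rule filter_cong) auto
  also have "\<dots> = map (\<lambda>x. q + x) (filter (\<lambda>x. 2 ^ j \<le> x) (bit_reversal (Suc j)))"
    unfolding Suc.prems(2) filter_map by (simp add: comp_def del: bit_reversal.simps)
  also have "\<dots> = map (\<lambda>x. q + 2 ^ j + x) (bit_reversal j)"
    unfolding filter_bit_reversal by (simp add: comp_def add_ac)
  finally have r: "j * 2 ^ j \<le> 2 * potential (Suc j) (2 * (q + 2 ^ j)) w"
    using Suc.prems(1) by (intro Suc.IH) simp_all
  obtain t where t: "w (2 * q) = map (\<lambda>x. 2 * x + 1) ?B @ t"
  proof -
    have "0 < (2::nat) ^ Suc j" by simp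
    then have "q < 2 ^ m" using Suc.prems(1) by linarith
    then show ?thesis using w that by blast
  qed
  have dbl: "2 * x + 1 \<in> {2 * q..<2 * q + 2 ^ Suc (Suc j)} \<longleftrightarrow> x \<in> {q..<q + 2 ^ Suc j}" for x
    by auto
  have "sides (Suc j) (2 * q) (map (\<lambda>x. 2 * x + 1) ?B)
      = map (\<lambda>x. 2 * x + 1 < 2 * q + 2 ^ Suc j) (filter (\<lambda>x. x \<in> {q..<q + 2 ^ Suc j}) ?B)"
    unfolding sides_def filter_map map_map comp_def dbl ..
  also have "\<dots> = map (\<lambda>x. x < 2 ^ j) (bit_reversal (Suc j))"
    unfolding Suc.prems(2) map_map comp_def by (intro map_cong) auto
  also have "\<dots> = concat (map (\<lambda>x. [x < 2 ^ j, x + 2 ^ j < 2 ^ j]) (bit_reversal j))"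
    by (simp add: map_concat comp_def)
  finally have "2 ^ j \<le> alternations (sides (Suc j) (2 * q) (map (\<lambda>x. 2 * x + 1) ?B))"
    using alternations_pairs[of "bit_reversal j" "\<lambda>x. x < 2 ^ j" "\<lambda>x. x + 2 ^ j < 2 ^ j"]
      bit_reversal_less by (simp add: length_bit_reversal)
  \<comment> \<open>Whatever follows the odd vertices in the list cannot decrease the number of
    alternations.\<close>
  also have "\<dots> \<le> alternations (sides (Suc j) (2 * q) (w (2 * q)))"
    unfolding t sides_append by (rule alternations_append_ge)
  finally show ?case using l r by (simp add: algebra_simps)
qed simp

section \<open>The square of a path\<close>

definition path_square :: "nat \<Rightarrow> nat rel" where
  "path_square n = {(i, j). i < n \<and> j < n \<and> i \<noteq> j \<and> i \<le> j + 2 \<and> j \<le> i + 2}"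

locale path_square =
  fixes n :: nat

sublocale path_square \<subseteq> symmetric_relation "path_square n"
  by unfold_locales (auto simp: sym_def path_square_def)

context path_square
begin

text \<open>An edge spans at most two, so a walk can jump over one missing vertex but not over two
  consecutive ones.\<close>

lemma joined_iff:
  assumes "U \<subseteq> {..<n}" "x \<le> y"
  shows "joined U x y \<longleftrightarrow> x \<in> U \<and> y \<in> U \<and> (\<forall>z. x < z \<and> Suc z < y \<longrightarrow> z \<in> U \<or> Suc z \<in> U)"
proof
  assume xy: "joined U x y"
  have "z \<in> U \<or> Suc z \<in> U" if z: "x < z" "Suc z < y" for z
  proof (rule ccontr)
    assume gap: "\<not> ?thesis"
    have "b < z" if "a < z" "b \<in> U" "(a, b) \<in> path_square n" for a b
    proof -
      have "b \<le> Suc z" using that by (auto simp: path_square_def)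
      moreover have "b \<noteq> z" "b \<noteq> Suc z" using gap that(2) by auto
      ultimately show ?thesis by simp
    qed
    then have "joined ({a. a < z} \<inter> U) x y" using xy z(1) by (intro joined_closed) auto
    then show False using z by (auto dest: joined_in)
  qed
  then show "x \<in> U \<and> y \<in> U \<and> (\<forall>z. x < z \<and> Suc z < y \<longrightarrow> z \<in> U \<or> Suc z \<in> U)"
    using xy by (auto dest: joined_in)
next
  assume "x \<in> U \<and> y \<in> U \<and> (\<forall>z. x < z \<and> Suc z < y \<longrightarrow> z \<in> U \<or> Suc z \<in> U)"
  with assms(2) show "joined U x y"
  proof (induction "y - x" arbitrary: x rule: less_induct)
    case less
    show ?case
    proof (cases "y \<le> x + 2")
      case True
      then have "x \<noteq> y \<Longrightarrow> (x, y) \<in> path_square n"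
        using less.prems assms(1) by (auto simp: path_square_def)
      then show ?thesis
        using less.prems joined_edge[of x U y] by (cases "x = y") (auto simp: joined_refl)
    next
      case False
      then have "Suc x \<in> U \<or> Suc (Suc x) \<in> U" using less.prems by auto
      then obtain w where w: "w \<in> U" "x < w" "w \<le> x + 2" by force
      have "joined U w y" by (rule less.hyps) (use w less.prems False in auto)
      moreover have "joined U x w"
        using w less.prems assms(1) by (intro joined_edge) (auto simp: path_square_def)
      ultimately show ?thesis by (blast intro: joined_trans)
    qed
  qed
qed

text \<open>A vertex outside an interval cannot belong to a gap between two points of it. Hence its
  removal never cuts a vertex of a dyadic interval off from the left end point.\<close>

lemma joined_remove:
  assumes "U \<subseteq> {..<n}" "joined U x y" "x \<in> {l..<h}" "y \<in> {l..<h}" "v \<notin> {l..<h}"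
  shows "joined (U - {v}) x y"
proof -
  have *: "joined (U - {v}) x y" if "joined U x y" "x \<le> y" "x \<in> {l..<h}" "y \<in> {l..<h}" for x y
  proof -
    have "U - {v} \<subseteq> {..<n}" using assms(1) by blast
    then show ?thesis using that assms(5) joined_iff[OF assms(1) that(2)] by (subst joined_iff) auto
  qed
  show ?thesis
    using *[of x y] *[of y x] assms joined_sym[of U x y] joined_sym[of "U - {v}" y x]
    by (cases "x \<le> y") auto
qed

text \<open>Of two consecutive vertices one is even, so no gap of length two arises.\<close>

lemma joined_even:
  assumes "U \<subseteq> {..<n}" "{z. even z \<and> z < n} \<subseteq> U" "x \<in> U" "y \<in> U"
  shows "joined U x y"
proof -
  have *: "joined U x y" if "x \<le> y" "x \<in> U" "y \<in> U" for x y
  proof -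
    have "y < n" using that assms(1) by blast
    then have "z \<in> U \<or> Suc z \<in> U" if "Suc z < y" for z
      using that subsetD[OF assms(2), of z] subsetD[OF assms(2), of "Suc z"] by fastforce
    then show ?thesis using that joined_iff[OF assms(1) that(1)] by blast
  qed
  show ?thesis using *[of x y] *[of y x] assms(3,4) joined_sym by (cases "x \<le> y") auto
qed

lemma connected_set_all: "n > 0 \<Longrightarrow> connected_set {..<n}"
  by (auto simp: connected_set_def intro: joined_even)

section \<open>Effect of a swap on the potential\<close>

lemma alternations_swap:
  fixes a b :: "nat list"
  assumes U: "U \<subseteq> {..<n}" and "u \<noteq> v" and p: "p \<in> {i..<i + 2 ^ Suc j}"
  defines "w \<equiv> ancestors (a @ u # v # b) U p" and "w' \<equiv> ancestors (a @ v # u # b) U p"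
  shows "alternations (sides j i w') \<le> alternations (sides j i w) + 4"
    and "u \<notin> {i..<i + 2 ^ Suc j} \<or> v \<notin> {i..<i + 2 ^ Suc j} \<or> (u < i + 2 ^ j \<longleftrightarrow> v < i + 2 ^ j) \<Longrightarrow>
      alternations (sides j i w') \<le> alternations (sides j i w)"
proof -
  let ?I = "{i..<i + 2 ^ Suc j}"
  define W where "W = U - set a"
  have W: "W \<subseteq> {..<n}" using U by (auto simp: W_def)
  \<comment> \<open>This is what two consecutive entries contribute to the list of ancestors; before
    and after it both orders agree.\<close>
  define block where "block x y =
    (if joined W x p then [x] else []) @ (if joined (W - {x}) y p then [y] else [])" for x y
  define \<alpha> \<gamma> where "\<alpha> = sides j i (ancestors a U p)" and "\<gamma> = sides j i (ancestors b (W - {u, v}) p)"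
  have uv: "W - {u} - {v} = W - {u, v}" "W - {v} - {u} = W - {u, v}" by auto
  have w: "sides j i w = \<alpha> @ sides j i (block u v) @ \<gamma>"
    "sides j i w' = \<alpha> @ sides j i (block v u) @ \<gamma>"
    unfolding w_def w'_def ancestors_append W_def[symmetric]
    by (simp_all add: sides_append \<alpha>_def \<gamma>_def block_def uv)
  have len: "length (sides j i (block v u)) \<le> 2"
    using length_sides_le[of j i "block v u"] by (auto simp: block_def split: if_splits)
  \<comment> \<open>Dropping the old block costs nothing, and the new block has at most two entries,
    each costing at most two. This is the origin of the constant 4.\<close>
  have "alternations (sides j i w') \<le> alternations (\<alpha> @ \<gamma>) + 4"
    using alternations_insert_list_le[of \<alpha> "sides j i (block v u)" \<gamma>] len w(2) by simp
  also have "\<dots> \<le> alternations (sides j i w) + 4"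
    using alternations_delete_list_le[of \<alpha> \<gamma> "sides j i (block u v)"] w(1) by simp
  finally show "alternations (sides j i w') \<le> alternations (sides j i w) + 4" .
  assume sep: "u \<notin> ?I \<or> v \<notin> ?I \<or> (u < i + 2 ^ j \<longleftrightarrow> v < i + 2 ^ j)"
  have "alternations (sides j i w') = alternations (sides j i w)"
  proof (cases "joined W u p \<and> joined W v p")
    \<comment> \<open>If at most one of the vertices is joined to \<open>p\<close>, that one is
      listed in either order and the other in neither.\<close>
    case False
    have "block u v = block v u"
      using False joined_remove_other[of W u p v] joined_remove_other[of W v p u]
        joined_mono[of "W - {u}" v p W] joined_mono[of "W - {v}" u p W]
      by (auto simp: block_def)
    then show ?thesis by (simp add: w)
  next
    case True
    have block: "block u v = u # (if joined (W - {u}) v p then [v] else [])"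
      "block v u = v # (if joined (W - {v}) u p then [u] else [])"
      using True by (simp_all add: block_def)
    consider "u \<notin> ?I" "v \<notin> ?I" | "u \<in> ?I" "v \<notin> ?I" | "u \<notin> ?I" "v \<in> ?I"
      | "u \<in> ?I" "v \<in> ?I" "u < i + 2 ^ j \<longleftrightarrow> v < i + 2 ^ j" using sep by blast
    then show ?thesis
    proof cases
      case 1
      then have "sides j i (block u v) = []" "sides j i (block v u) = []"
        unfolding block sides_def by auto
      then show ?thesis by (simp add: w)
    next
      \<comment> \<open>Removing \<open>v\<close> from outside the interval does not separate
        \<open>u\<close> from \<open>p\<close>, so \<open>u\<close> is listed in both orders, and
        \<open>v\<close> is filtered out.\<close>
      case 2
      then have "joined (W - {v}) u p" using joined_remove[OF W, of u p] True p by blast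
      then have "sides j i (block u v) = sides j i (block v u)"
        using 2 unfolding block sides_def by auto
      then show ?thesis by (simp add: w)
    next
      case 3
      then have "joined (W - {u}) v p" using joined_remove[OF W, of v p] True p by blast
      then have "sides j i (block u v) = sides j i (block v u)"
        using 3 unfolding block sides_def by auto
      then show ?thesis by (simp add: w)
    next
      case 4
      \<comment> \<open>Both blocks reduce to one or two copies of the same side, and repetitions do
        not alternate.\<close>
      define c where "c = (u < i + 2 ^ j)"
      have "sides j i (block u v) \<in> {[c], [c, c]}" "sides j i (block v u) \<in> {[c], [c, c]}"
        using 4 unfolding block sides_def by (auto simp: c_def)
      then show ?thesis using alternations_duplicate[of \<alpha> c \<gamma>] by (auto simp: w)
    qed
  qed
  then show "alternations (sides j i w') \<le> alternations (sides j i w)" by simp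
qed

lemma potential_swap:
  assumes "u \<noteq> v"
  shows "potential j 0 (ancestors (a @ v # u # b) {..<n}) \<le>
    potential j 0 (ancestors (a @ u # v # b) {..<n}) + 4"
  by (rule potential_exchange(1)[where N = "2 ^ j" and u = u and v = v])
    (use assms in \<open>auto intro!: alternations_swap\<close>)

text \<open>At each step the current order is exchanged for one in which the rotation is a swap; the
  relevant ancestor lists stay the same. The hypothesis on \<open>2 ^ j\<close> makes all left end
  points vertices.\<close>

lemma rotations_potential_le:
  assumes "2 ^ j \<le> n" "(S, T) \<in> {(S, T). stree {..<n} S \<and> stree {..<n} T \<and> rotation S T} ^^ d"
    and "S = elim_tree s {..<n}" "T = elim_tree t {..<n}" "{..<n} \<subseteq> set s" "{..<n} \<subseteq> set t"
  shows "potential j 0 (ancestors s {..<n}) \<le> potential j 0 (ancestors t {..<n}) + 4 * d"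
  using assms(2,3,5)
proof (induction d arbitrary: S s)
  case 0
  have "n > 0" using assms(1) by (cases "n = 0") auto
  then have "connected_set {..<n}" by (rule connected_set_all)
  then have "potential j 0 (ancestors s {..<n}) = potential j 0 (ancestors t {..<n})"
    using 0 assms by (intro potential_cong ancestors_cong) auto
  then show ?case by simp
next
  case (Suc d)
  have "n > 0" using assms(1) by (cases "n = 0") auto
  then have conn: "connected_set {..<n}" by (rule connected_set_all)
  from Suc.prems(1) obtain R where R: "stree {..<n} S" "stree {..<n} R" "rotation S R"
    "(R, T) \<in> {(S, T). stree {..<n} S \<and> stree {..<n} T \<and> rotation S T} ^^ d"
    by (rule relpow_Suc_E2) blast
  obtain a u v b where ab: "distinct (a @ u # v # b)" "set (a @ u # v # b) = {..<n}"
    "S = elim_tree (a @ u # v # b) {..<n}" "R = elim_tree (a @ v # u # b) {..<n}"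
    using rotation_imp_swap[OF R(1-3) _ conn] by auto
  have "potential j 0 (ancestors s {..<n}) = potential j 0 (ancestors (a @ u # v # b) {..<n})"
    using conn Suc.prems ab assms(1) by (intro potential_cong ancestors_cong) auto
  also have "\<dots> \<le> potential j 0 (ancestors (a @ v # u # b) {..<n}) + 4"
    using ab(1) by (intro potential_swap) auto
  also have "potential j 0 (ancestors (a @ v # u # b) {..<n}) \<le>
      potential j 0 (ancestors t {..<n}) + 4 * d"
    using Suc.IH[OF R(4) ab(4)] ab(2) by auto
  finally show ?case by simp
qed

section \<open>Two trees of very different potential\<close>

text \<open>When \<open>m\<close> is removed, only vertices from \<open>m\<close> on are left, and
  \<open>p\<close> must be one of them.\<close>

lemma ancestors_upt: "x \<in> set (ancestors [m..<k] {m..<k} p) \<Longrightarrow> x \<le> p"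
proof (induction "k - m" arbitrary: m)
  case (Suc i)
  then have "[m..<k] = m # [Suc m..<k]" "{m..<k} - {m} = {Suc m..<k}" by (auto simp: upt_conv_Cons)
  then have anc: "ancestors [m..<k] {m..<k} p
      = (if joined {m..<k} m p then [m] else []) @ ancestors [Suc m..<k] {Suc m..<k} p"
    by (simp only: ancestors.simps)
  have "m \<le> p" if "joined {m..<k} m p" using joined_in(2)[OF that] by simp
  moreover have "x \<le> p" if "x \<in> set (ancestors [Suc m..<k] {Suc m..<k} p)"
  proof (rule Suc.hyps(1))
    show "i = k - Suc m" using Suc.hyps(2) by simp
  qed (fact that)
  ultimately show ?case using Suc.prems unfolding anc by (auto split: if_splits)
qed simp

text \<open>No ancestor of the left end point \<open>i\<close> exceeds \<open>i\<close>, so none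
  lies in the right half.\<close>

lemma potential_upt: "potential j i (ancestors [0..<n] {..<n}) = 0"
proof (induction j arbitrary: i)
  case (Suc j)
  have "x < i + 2 ^ j" if "x \<in> set (ancestors [0..<n] {..<n} i)" for x
    using ancestors_upt[of x 0 n i] that by (simp add: atLeast0LessThan le_less_trans)
  then have "alternations (sides j i (ancestors [0..<n] {..<n} i)) = 0"
    by (intro alternations_const[of _ True]) (auto simp: sides_def)
  then show ?case using Suc by simp
qed simp

text \<open>While only odd vertices have been removed, all remaining vertices are joined to
  \<open>p\<close>, so each removed one is an ancestor.\<close>

lemma ancestors_odd_prefix:
  assumes "U \<subseteq> {..<n}" "{z. even z \<and> z < n} \<subseteq> U" "p < n" "even p"
    and "distinct s" "set s \<subseteq> U" "\<forall>x\<in>set s. odd x"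
  shows "ancestors (s @ t) U p = s @ ancestors t (U - set s) p"
  using assms
proof (induction s arbitrary: U)
  case (Cons x s)
  have "joined U x p" using Cons.prems by (intro joined_even) auto
  moreover have "ancestors (s @ t) (U - {x}) p = s @ ancestors t (U - {x} - set s) p"
    using Cons.prems by (intro Cons.IH) auto
  moreover have "U - {x} - set s = U - set (x # s)" by auto
  ultimately show ?case by simp
qed simp

text \<open>The tree that eliminates the odd vertices in bit-reversal order is far from the tree that
  eliminates all vertices from left to right.\<close>

lemma rotation_distance_ge:
  assumes "2 ^ Suc m \<le> n"
  obtains S T where "stree {..<n} S" "stree {..<n} T"
    "\<And>d. (S, T) \<in> {(S, T). stree {..<n} S \<and> stree {..<n} T \<and> rotation S T} ^^ d \<Longrightarrow> m * 2 ^ m \<le> 8 * d"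
proof -
  define odds where "odds = map (\<lambda>x. 2 * x + 1) (bit_reversal m)"
  \<comment> \<open>The second part supplies the even vertices and any odd ones beyond the range of
    \<open>odds\<close>; repeated entries are skipped.\<close>
  define s where "s = odds @ [0..<n]"
  have odds: "distinct odds" "set odds \<subseteq> {..<n}" "\<forall>x\<in>set odds. odd x"
    using distinct_bit_reversal[of m] bit_reversal_less[of _ m] assms
    by (fastforce simp: odds_def distinct_map inj_on_def)+
  have "m * 2 ^ m \<le> 2 * potential (Suc m) (2 * 0) (ancestors s {..<n})"
  proof (rule potential_bit_reversal)
    fix q :: nat assume "q < 2 ^ m"
    then have "ancestors s {..<n} (2 * q) = odds @ ancestors [0..<n] ({..<n} - set odds) (2 * q)"
      unfolding s_def using assms odds by (intro ancestors_odd_prefix) auto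
    then show "\<exists>t. ancestors s {..<n} (2 * q) = map (\<lambda>x. 2 * x + 1) (bit_reversal m) @ t"
      unfolding odds_def by blast
  next
    show "filter (\<lambda>x. x \<in> {0..<0 + 2 ^ m}) (bit_reversal m) = map (\<lambda>x. 0 + x) (bit_reversal m)"
      using bit_reversal_less by (auto intro: filter_True)
  qed simp
  \<comment> \<open>The left-to-right tree has potential zero, and each rotation accounts for at
    most 4. With the factor 2 above this gives the 8.\<close>
  moreover have "potential (Suc m) 0 (ancestors s {..<n}) \<le> 4 * d"
    if "(elim_tree s {..<n}, elim_tree [0..<n] {..<n}) \<in>
      {(S, T). stree {..<n} S \<and> stree {..<n} T \<and> rotation S T} ^^ d" for d
    using rotations_potential_le[OF assms that refl refl] unfolding potential_upt
    by (auto simp: s_def atLeast0LessThan simp del: potential.simps)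
  moreover have "n > 0" using assms by (cases "n = 0") auto
  then have "stree {..<n} (elim_tree s {..<n})" "stree {..<n} (elim_tree [0..<n] {..<n})"
    by (auto intro!: stree_elim_tree simp: s_def)
  ultimately show ?thesis using that[of "elim_tree s {..<n}" "elim_tree [0..<n] {..<n}"] by fastforce
qed

end

section \<open>Search trees on graphs\<close>

sublocale pair_graph \<subseteq> rel: symmetric_relation "parcs G"
  by unfold_locales (use pair_sym_arcs in \<open>simp add: symmetric_def\<close>)

context pair_graph
begin

lemma arcs_ends_induce: "arcs_ends (with_proj G \<restriction> W) = parcs G \<inter> W \<times> W"
  by (auto simp: arcs_ends_conv)

lemma reachable_induce: "u \<rightarrow>\<^sup>*\<^bsub>with_proj G \<restriction> W\<^esub> v \<longleftrightarrow> rel.joined W u v"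
proof
  assume "u \<rightarrow>\<^sup>*\<^bsub>with_proj G \<restriction> W\<^esub> v"
  then show "rel.joined W u v"
    unfolding reachable_def arcs_ends_induce rel.joined_def induce_subgraph_verts
    using in_rtrancl_on_in_F rtrancl_on_rtranclI by metis
next
  assume "rel.joined W u v"
  then show "u \<rightarrow>\<^sup>*\<^bsub>with_proj G \<restriction> W\<^esub> v"
    unfolding reachable_def arcs_ends_induce rel.joined_def induce_subgraph_verts
    by (intro rtrancl_consistent_rtrancl_on) auto
qed

lemma sccs_verts_induce: "pre_digraph.sccs_verts (with_proj G \<restriction> W) = rel.components W"
proof (intro set_eqI iffI)
  fix S assume "S \<in> pre_digraph.sccs_verts (with_proj G \<restriction> W)"
  then have S: "S \<noteq> {}" "\<forall>u\<in>S. \<forall>v\<in>S. rel.joined W u v"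
    "\<forall>u\<in>S. \<forall>v. v \<notin> S \<longrightarrow> \<not> rel.joined W u v \<or> \<not> rel.joined W v u"
    by (auto simp: pre_digraph.sccs_verts_def reachable_induce)
  then obtain x where x: "x \<in> S" by blast
  then have "S = rel.component W x"
    using S rel.joined_sym by (auto simp: rel.component_def)
  moreover have "x \<in> W" using S x rel.joined_in by blast
  ultimately show "S \<in> rel.components W" by (simp add: rel.component_in_components)
next
  fix S assume "S \<in> rel.components W"
  then obtain x where x: "x \<in> W" "S = rel.component W x" by (auto simp: rel.components_def)
  then have S: "u \<in> S \<longleftrightarrow> rel.joined W x u" for u by (simp add: rel.component_def)
  have "x \<in> S" using x by (simp add: rel.mem_component)
  moreover have "rel.joined W u v" if "u \<in> S" "v \<in> S" for u v
    using that rel.joined_trans[OF rel.joined_sym] unfolding S by blast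
  moreover have "v \<in> S" if "u \<in> S" "rel.joined W u v" for u v
    using that rel.joined_trans unfolding S by blast
  ultimately show "S \<in> pre_digraph.sccs_verts (with_proj G \<restriction> W)"
    unfolding pre_digraph.sccs_verts_def reachable_induce by blast
qed

lemma induce_induce: "H \<subseteq> W \<Longrightarrow> (with_proj G \<restriction> W) \<restriction> H = with_proj G \<restriction> H"
  by (auto simp: induce_subgraph_def)

lemma sccs_induce:
  "pre_digraph.sccs (with_proj G \<restriction> W) = (\<lambda>H. with_proj G \<restriction> H) ` rel.components W"
proof -
  interpret W: wf_digraph "with_proj G \<restriction> W" by (rule wellformed_induce_subgraph)
  have "pre_digraph.sccs (with_proj G \<restriction> W) = (\<lambda>H. (with_proj G \<restriction> W) \<restriction> H) ` rel.components W"
    using W.sccs_conv_sccs_verts by (simp add: sccs_verts_induce)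
  then show ?thesis using rel.components_subset induce_induce by (metis (no_types, lifting) image_cong)
qed

lemma del_vert_induce: "pre_digraph.del_vert (with_proj G \<restriction> U) r = with_proj G \<restriction> (U - {r})"
  by (auto simp: pre_digraph.del_vert_def induce_subgraph_def)

lemma stree_imp_search_tree: "rel.stree U T \<Longrightarrow> search_tree (with_proj G \<restriction> U) T"
proof (induction rule: rel.stree.induct)
  case (stree_Node r U f ts)
  show ?case
  \<comment> \<open>\<open>search_tree\<close> indexes the choice of subtrees by component graphs,
    \<open>stree\<close> by vertex sets; \<open>verts\<close> converts between them.\<close>
  proof (rule search_tree.intros[where f = "f \<circ> verts"])
    show "r \<in> verts (with_proj G \<restriction> U)" using stree_Node.hyps by simp
    show "search_tree H ((f \<circ> verts) H)"
      if "H \<in> pre_digraph.sccs (pre_digraph.del_vert (with_proj G \<restriction> U) r)" for H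
      using that stree_Node.IH by (auto simp: del_vert_induce sccs_induce)
    show "fset ts = (f \<circ> verts) ` pre_digraph.sccs (pre_digraph.del_vert (with_proj G \<restriction> U) r)"
      using stree_Node.hyps by (simp add: del_vert_induce sccs_induce image_image)
  qed
qed

lemma search_tree_imp_stree: "search_tree K T \<Longrightarrow> K = with_proj G \<restriction> U \<Longrightarrow> rel.stree U T"
proof (induction arbitrary: U rule: search_tree.induct)
  case (1 r K f ts)
  show ?case
  proof (rule rel.stree_Node[where f = "\<lambda>H. f (with_proj G \<restriction> H)"])
    show "r \<in> U" using 1 by simp
    show "rel.stree H (f (with_proj G \<restriction> H))" if "H \<in> rel.components (U - {r})" for H
      using that 1 by (auto simp: del_vert_induce sccs_induce)
    show "fset ts = (\<lambda>H. f (with_proj G \<restriction> H)) ` rel.components (U - {r})"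
      using 1 by (simp add: del_vert_induce sccs_induce image_image)
  qed
qed

lemma induce_all: "with_proj G \<restriction> pverts G = with_proj G"
  using in_arcsD1 in_arcsD2 by (auto simp: induce_subgraph_def with_proj_def)

lemma search_tree_iff: "search_tree (with_proj G) T \<longleftrightarrow> rel.stree (pverts G) T"
  using stree_imp_search_tree[of "pverts G" T] search_tree_imp_stree[of "with_proj G" T "pverts G"]
  by (auto simp: induce_all)

lemma connected_set_pverts:
  assumes "Digraph_Component.connected (with_proj G)"
  shows "rel.connected_set (pverts G)"
proof -
  have "pverts G \<noteq> {}" "\<forall>u\<in>pverts G. \<forall>v\<in>pverts G. u \<rightarrow>\<^sup>*\<^bsub>with_proj G\<^esub> v"
    using assms reachable_mk_symmetric_eq[OF pair_sym_arcs]
    by (auto simp: Digraph_Component.connected_def strongly_connected_def)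
  then show ?thesis
    using reachable_induce[where W = "pverts G"] by (simp add: rel.connected_set_def induce_all)
qed

abbreviation rotation_rel :: "'a rtree rel" where
  "rotation_rel \<equiv> {(S, T). rel.stree (pverts G) S \<and> rel.stree (pverts G) T \<and> rel.rotation S T}"

lemma rotation_graph_simps:
  "pverts (rotation_graph (with_proj G)) = {T. rel.stree (pverts G) T}"
  "parcs (rotation_graph (with_proj G)) = rotation_rel"
  by (simp_all add: rotation_graph_def search_tree_iff rel.rotation_def)

lemma awalk_imp_relpow:
  "pre_digraph.awalk (with_proj (rotation_graph (with_proj G))) S p T \<Longrightarrow> (S, T) \<in> rotation_rel ^^ length p"
proof (induction p arbitrary: S)
  interpret R: wf_digraph "with_proj (rotation_graph (with_proj G))" by (rule wf_digraph_rotation_graph)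
  {
    case Nil
    then show ?case by (simp add: R.awalk_Nil_iff)
  next
    case (Cons e p)
    then show ?case by (auto simp: R.awalk_Cons_iff rotation_graph_simps intro: relpow_Suc_I2
          simp del: relpow.simps(2))
  }
qed

text \<open>\<open>flip\<close> allows standing still; such steps are dropped, so the walk may be
  shorter than \<open>d\<close>.\<close>

lemma flips_imp_awalk:
  "(S, T) \<in> rel.flip (pverts G) ^^ d \<Longrightarrow> rel.stree (pverts G) S \<Longrightarrow>
    \<exists>p. pre_digraph.awalk (with_proj (rotation_graph (with_proj G))) S p T \<and> length p \<le> d"
proof (induction d arbitrary: S)
  interpret R: wf_digraph "with_proj (rotation_graph (with_proj G))" by (rule wf_digraph_rotation_graph)
  {
    case 0
    then have "R.awalk S [] T" by (simp add: R.awalk_Nil_iff rotation_graph_simps)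
    then show ?case by force
  next
    case (Suc d)
    from Suc.prems(1) obtain S' where S': "(S, S') \<in> rel.flip (pverts G)"
      "(S', T) \<in> rel.flip (pverts G) ^^ d" by (rule relpow_Suc_E2)
    then obtain p where p: "R.awalk S' p T" "length p \<le> d"
      using Suc.IH Suc.prems(2) unfolding rel.flip_def by blast
    show ?case
    proof (cases "S = S'")
      case True
      then show ?thesis using p by (auto intro: le_SucI)
    next
      case False
      then have "R.awalk S ((S, S') # p) T"
        using S'(1) p(1) by (auto simp: R.awalk_Cons_iff rotation_graph_simps rel.flip_def)
      then show ?thesis using p(2) by (intro exI[of _ "(S, S') # p"]) simp
    qed
  }
qed

lemma graph_diameter_le:
  assumes "rel.diameter_le (pverts G) d"
  shows "graph_diameter (with_proj (rotation_graph (with_proj G))) \<le> ereal d"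
proof -
  interpret R: wf_digraph "with_proj (rotation_graph (with_proj G))" by (rule wf_digraph_rotation_graph)
  have "R.\<mu> (\<lambda>_. 1) S T \<le> ereal d" if st: "rel.stree (pverts G) S" "rel.stree (pverts G) T" for S T
  proof -
    obtain p where p: "R.awalk S p T" "length p \<le> d"
      using flips_imp_awalk assms[unfolded rel.diameter_le_def] st by blast
    have "R.\<mu> (\<lambda>_. 1) S T \<le> R.awalk_cost (\<lambda>_. 1) p" using p(1) by (rule R.min_cost_le_walk_cost)
    also have "\<dots> \<le> ereal d" using p(2) by (simp add: R.awalk_cost_def sum_list_triv)
    finally show ?thesis .
  qed
  then show ?thesis unfolding graph_diameter_def
    by (intro SUP_least) (simp_all add: rotation_graph_simps)
qed

lemma graph_diameter_ge:
  assumes "rel.stree (pverts G) S" "rel.stree (pverts G) T"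
    and "\<And>d. (S, T) \<in> rotation_rel ^^ d \<Longrightarrow> c \<le> real d"
  shows "ereal c \<le> graph_diameter (with_proj (rotation_graph (with_proj G)))"
proof -
  interpret R: wf_digraph "with_proj (rotation_graph (with_proj G))" by (rule wf_digraph_rotation_graph)
  have "ereal c \<le> R.\<mu> (\<lambda>_. 1) S T"
    unfolding R.\<mu>_def
  proof (rule INF_greatest)
    fix p assume "p \<in> {p. R.awalk S p T}"
    then have "c \<le> length p" using assms(3) awalk_imp_relpow by blast
    then show "ereal c \<le> ereal (R.awalk_cost (\<lambda>_. 1) p)" by (simp add: R.awalk_cost_def sum_list_triv)
  qed
  then show ?thesis unfolding graph_diameter_def
    using assms(1,2) by (intro SUP_upper2[of S] SUP_upper2[of T]) (simp_all add: rotation_graph_simps)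
qed

end

section \<open>Pathwidth two\<close>

lemma finite_clique_sizes:
  "finite (verts G) \<Longrightarrow> finite {k. \<exists>K. complete_digraph k K \<and> subgraph K G}"
proof -
  assume "finite (verts G)"
  then have "{k. \<exists>K. complete_digraph k K \<and> subgraph K G} \<subseteq> {..card (verts G)}"
    by (auto simp: complete_digraph_def subgraph_def intro: card_mono)
  then show ?thesis by (rule finite_subset) simp
qed

lemma clique_number_ge:
  assumes "graph (with_proj H)" "S \<subseteq> pverts H" "\<And>u v. u \<in> S \<Longrightarrow> v \<in> S \<Longrightarrow> u \<noteq> v \<Longrightarrow> (u, v) \<in> parcs H"
  shows "card S \<le> clique_number (with_proj H)"
proof -
  interpret H: graph "with_proj H" by fact
  define K where "K = \<lparr>pverts = S, parcs = {(u, v). (u, v) \<in> S \<times> S \<and> u \<noteq> v}\<rparr>"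
  have fin: "finite (pverts H)" using H.finite_verts by simp
  then have "finite S" using assms(2) finite_subset by blast
  then have "complete_digraph (card S) (with_proj K)"
    by (simp add: complete_digraph_pair_def K_def)
  moreover from this have "wf_digraph (with_proj K)"
    by (simp add: complete_digraph_def graph_def digraph_def fin_digraph_def)
  then have "subgraph (with_proj K) (with_proj H)"
    using assms(2,3) H.wf_digraph by (intro subgraphI) (auto simp: K_def)
  ultimately show ?thesis
    unfolding clique_number_def using fin by (intro Max_ge finite_clique_sizes) auto
qed

lemma clique_number_le:
  assumes "graph (with_proj H)"
    and "\<And>S. S \<subseteq> pverts H \<Longrightarrow> (\<And>u v. u \<in> S \<Longrightarrow> v \<in> S \<Longrightarrow> u \<noteq> v \<Longrightarrow> (u, v) \<in> parcs H) \<Longrightarrow> card S \<le> k"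
  shows "clique_number (with_proj H) \<le> k"
proof -
  interpret H: graph "with_proj H" by fact
  let ?A = "{k. \<exists>K. complete_digraph k K \<and> subgraph K (with_proj H)}"
  have fin: "finite (pverts H)" using H.finite_verts by simp
  have le: "m \<le> k" if m: "m \<in> ?A" for m
  proof -
    obtain K where K: "complete_digraph m K" "subgraph K (with_proj H)" using m by blast
    have "(u, v) \<in> parcs H" if "u \<in> verts K" "v \<in> verts K" "u \<noteq> v" for u v
      using arcs_ends_mono[OF K(2)] K(1) that by (auto simp: complete_digraph_def)
    moreover have "verts K \<subseteq> pverts H" using K(2) by (auto simp: subgraph_def)
    ultimately show ?thesis using assms(2)[of "verts K"] K(1) by (auto simp: complete_digraph_def)
  qed
  \<comment> \<open>The empty digraph is complete on no vertices, so \<open>Max\<close> is not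
    applied to an empty set.\<close>
  have "?A \<noteq> {}"
  proof -
    define K :: "'a pair_pre_digraph" where "K = \<lparr>pverts = {}, parcs = {}\<rparr>"
    have "complete_digraph 0 (with_proj K)" by (simp add: complete_digraph_pair_def K_def)
    moreover from this have "wf_digraph (with_proj K)"
      by (simp add: complete_digraph_def graph_def digraph_def fin_digraph_def)
    then have "subgraph (with_proj K) (with_proj H)"
      using H.wf_digraph by (intro subgraphI) (auto simp: K_def)
    ultimately show ?thesis by blast
  qed
  then show ?thesis unfolding clique_number_def using le fin finite_clique_sizes[of "with_proj H"] by simp
qed

text \<open>The complete graph on the same vertices serves, all intervals being the same point. It
  guarantees that the minimum defining pathwidth is attained.\<close>

lemma ex_interval_supergraph:
  assumes "pair_graph G"
  shows "\<exists>H. interval_graph (with_proj H) \<and> subgraph (with_proj G) (with_proj H)"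
proof -
  interpret pair_graph G by fact
  define H where "H = \<lparr>pverts = pverts G, parcs = {(u, v). (u, v) \<in> pverts G \<times> pverts G \<and> u \<noteq> v}\<rparr>"
  have "complete_digraph (card (pverts G)) (with_proj H)"
    using pair_finite_verts by (simp add: complete_digraph_pair_def H_def)
  then have H: "graph (with_proj H)" by (simp add: complete_digraph_def)
  then have "interval_graph (with_proj H)"
    unfolding interval_graph_def by (auto simp: H_def intro!: exI[of _ "\<lambda>_. 0"])
  moreover have "subgraph (with_proj G) (with_proj H)"
  proof (rule subgraphI)
    show "arcs (with_proj G) \<subseteq> arcs (with_proj H)"
      using arc_fst_in_verts arc_snd_in_verts pair_no_loops by (fastforce simp: H_def)
    show "wf_digraph (with_proj H)" using H by (simp add: graph_def digraph_def fin_digraph_def)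
  qed (auto simp: H_def intro: wf_digraph)
  ultimately show ?thesis by blast
qed

lemma pathwidth_eq_twoE:
  assumes "pair_graph G" "pathwidth G = 2"
  obtains l r :: "'a \<Rightarrow> real" where "\<And>v. v \<in> pverts G \<Longrightarrow> l v \<le> r v"
    "\<And>u v. u \<in> pverts G \<Longrightarrow> v \<in> pverts G \<Longrightarrow> (u, v) \<in> parcs G \<Longrightarrow> {l u..r u} \<inter> {l v..r v} \<noteq> {}"
    "\<And>x. card {v \<in> pverts G. l v \<le> x \<and> x \<le> r v} \<le> 3"
proof -
  interpret pair_graph G by fact
  let ?P = "\<lambda>k. \<exists>H. interval_graph (with_proj H) \<and> subgraph (with_proj G) (with_proj H) \<and>
    clique_number (with_proj H) = k"
  have "\<exists>k. ?P k" using ex_interval_supergraph[OF assms(1)] by blast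
  then have "?P (LEAST k. ?P k)" by (rule LeastI_ex)
  \<comment> \<open>Truncated subtraction is harmless, since the difference is positive.\<close>
  moreover have "(LEAST k. ?P k) = 3" using assms(2) unfolding pathwidth_def by linarith
  ultimately obtain H where H: "interval_graph (with_proj H)" "subgraph (with_proj G) (with_proj H)"
    "clique_number (with_proj H) = 3" by auto
  obtain l r :: "'a \<Rightarrow> real" where lr: "\<forall>v\<in>pverts H. l v \<le> r v"
    "\<forall>u\<in>pverts H. \<forall>v\<in>pverts H. u \<noteq> v \<longrightarrow> ((u, v) \<in> parcs H \<longleftrightarrow> {l u..r u} \<inter> {l v..r v} \<noteq> {})"
    and gH: "graph (with_proj H)"
    using H(1) unfolding interval_graph_def with_proj_simps by blast
  have sub: "pverts G \<subseteq> pverts H" "parcs G \<subseteq> parcs H" using H(2) by (auto simp: subgraph_def)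
  show ?thesis
  proof (rule that[of l r])
    show "l v \<le> r v" if "v \<in> pverts G" for v using that sub lr(1) by blast
    show "{l u..r u} \<inter> {l v..r v} \<noteq> {}" if "u \<in> pverts G" "v \<in> pverts G" "(u, v) \<in> parcs G" for u v
      using that sub lr(2) pair_no_loops[OF that(3)] by auto
    \<comment> \<open>Intervals sharing the point \<open>x\<close> meet pairwise and so form a
      clique of \<open>H\<close>.\<close>
    show "card {v \<in> pverts G. l v \<le> x \<and> x \<le> r v} \<le> 3" for x
      unfolding H(3)[symmetric] using gH
    proof (rule clique_number_ge)
      fix u v assume uv: "u \<in> {v \<in> pverts G. l v \<le> x \<and> x \<le> r v}" "v \<in> {v \<in> pverts G. l v \<le> x \<and> x \<le> r v}"
        "u \<noteq> v"
      then have "x \<in> {l u..r u} \<inter> {l v..r v}" by simp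
      then have "{l u..r u} \<inter> {l v..r v} \<noteq> {}" by blast
      then show "(u, v) \<in> parcs H" using uv sub lr(2) by blast
    qed (use sub in blast)
  qed
qed

definition path_square_graph :: "nat \<Rightarrow> nat pair_pre_digraph" where
  "path_square_graph n = \<lparr>pverts = {..<n}, parcs = path_square n\<rparr>"

lemma path_square_graph_simps [simp]:
  "pverts (path_square_graph n) = {..<n}" "parcs (path_square_graph n) = path_square n"
  by (simp_all add: path_square_graph_def)

lemma pair_graph_path_square: "pair_graph (path_square_graph n)"
proof
  have "path_square n \<subseteq> {..<n} \<times> {..<n}" by (auto simp: path_square_def)
  then show "finite (parcs (path_square_graph n))" by (auto intro: finite_subset)
qed (auto simp: path_square_def symmetric_def sym_def)

lemma interval_graph_path_square: "interval_graph (with_proj (path_square_graph n))"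
proof -
  have "graph (with_proj (path_square_graph n))"
    using pair_graph.pair_graphD_graph[OF pair_graph_path_square] .
  moreover have "(u, v) \<in> path_square n \<longleftrightarrow> {real u..real u + 2} \<inter> {real v..real v + 2} \<noteq> {}"
    if "u < n" "v < n" "u \<noteq> v" for u v
    using that by (auto simp: path_square_def)
  ultimately show ?thesis unfolding interval_graph_def
    by (intro conjI exI[of _ real] exI[of _ "\<lambda>v. real v + 2"] ballI impI) simp_all
qed

text \<open>All vertices of a clique lie within distance two of the least one.\<close>

lemma clique_number_path_square: "clique_number (with_proj (path_square_graph n)) \<le> 3"
proof (rule clique_number_le)
  show "graph (with_proj (path_square_graph n))"
    using pair_graph.pair_graphD_graph[OF pair_graph_path_square] .
  fix S assume S: "S \<subseteq> pverts (path_square_graph n)"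
    and clique: "\<And>u v. u \<in> S \<Longrightarrow> v \<in> S \<Longrightarrow> u \<noteq> v \<Longrightarrow> (u, v) \<in> parcs (path_square_graph n)"
  show "card S \<le> 3"
  proof (cases "S = {}")
    case False
    have fin: "finite S" using S finite_subset by auto
    have "v \<in> {Min S..Min S + 2}" if "v \<in> S" for v
      using clique[of v "Min S"] that fin False by (cases "v = Min S") (auto simp: path_square_def)
    then have "card S \<le> card {Min S..Min S + 2}" by (intro card_mono) auto
    then show ?thesis by simp
  qed simp
qed

text \<open>The triangle on 0, 1, 2 forces clique number at least 3 on every supergraph, and the
  graph is an optimal interval supergraph of itself.\<close>

lemma pathwidth_path_square:
  assumes "n \<ge> 3"
  shows "pathwidth (path_square_graph n) = 2"
proof -
  interpret pair_graph "path_square_graph n" by (rule pair_graph_path_square)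
  have three: "3 \<le> clique_number (with_proj H)"
    if "interval_graph (with_proj H)" "subgraph (with_proj (path_square_graph n)) (with_proj H)"
    for H :: "nat pair_pre_digraph"
  proof -
    have "card {0, 1, 2 :: nat} \<le> clique_number (with_proj H)"
    proof (rule clique_number_ge)
      show "graph (with_proj H)" using that by (simp add: interval_graph_def)
      show "{0, 1, 2} \<subseteq> pverts H" using that(2) assms by (auto simp: subgraph_def)
      have "parcs (path_square_graph n) \<subseteq> parcs H" using that(2) by (auto simp: subgraph_def)
      then show "(u, v) \<in> parcs H" if "u \<in> {0, 1, 2}" "v \<in> {0, 1, 2}" "u \<noteq> v" for u v
        using that assms by (auto simp: path_square_def)
    qed
    then show ?thesis by simp
  qed
  have self: "subgraph (with_proj (path_square_graph n)) (with_proj (path_square_graph n))"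
    by (rule subgraph_refl)
  have "(LEAST k. \<exists>H :: nat pair_pre_digraph. interval_graph (with_proj H) \<and>
    subgraph (with_proj (path_square_graph n)) (with_proj H) \<and> clique_number (with_proj H) = k) = 3"
  proof (rule Least_equality)
    show "\<exists>H :: nat pair_pre_digraph. interval_graph (with_proj H) \<and>
      subgraph (with_proj (path_square_graph n)) (with_proj H) \<and> clique_number (with_proj H) = 3"
      using interval_graph_path_square[of n] self three clique_number_path_square[of n] le_antisym by blast
  qed (use three in blast)
  then show ?thesis unfolding pathwidth_def by simp
qed

lemma connected_path_square:
  assumes "n > 0"
  shows "Digraph_Component.connected (with_proj (path_square_graph n))"
proof -
  interpret G: pair_graph "path_square_graph n" by (rule pair_graph_path_square)
  interpret P: path_square n .
  have "P.connected_set {..<n}" using assms by (rule P.connected_set_all)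
  then have "\<forall>u\<in>{..<n}. \<forall>v\<in>{..<n}. u \<rightarrow>\<^sup>*\<^bsub>with_proj (path_square_graph n)\<^esub> v"
    using G.reachable_induce[where W = "{..<n}"] G.induce_all by (simp add: P.connected_set_def)
  then show ?thesis
    using assms G.reachable_mk_symmetric_eq[OF G.pair_sym_arcs]
    by (auto simp: Digraph_Component.connected_def strongly_connected_def)
qed

section \<open>The maximum diameter\<close>

lemma diameter_pathwidth_two_le:
  assumes "G \<in> pathwidth_two_graphs" "card (pverts G) < 2 ^ j"
  shows "graph_diameter (with_proj (rotation_graph (with_proj G))) \<le> ereal (6 * j * card (pverts G))"
proof -
  have G: "pair_graph G" "Digraph_Component.connected (with_proj G)" "pathwidth G = 2"
    using assms(1) by (auto simp: pathwidth_two_graphs_def)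
  interpret pair_graph G by fact
  obtain l r :: "nat \<Rightarrow> real" where lr: "\<And>v. v \<in> pverts G \<Longrightarrow> l v \<le> r v"
    "\<And>u v. u \<in> pverts G \<Longrightarrow> v \<in> pverts G \<Longrightarrow> (u, v) \<in> parcs G \<Longrightarrow> {l u..r u} \<inter> {l v..r v} \<noteq> {}"
    "\<And>x. card {v \<in> pverts G. l v \<le> x \<and> x \<le> r v} \<le> 3"
    using pathwidth_eq_twoE[OF G(1,3)] by blast
  have "rel.diameter_le (pverts G) (2 * 3 * j * card (pverts G))"
    using rel.diameter_le_interval[OF lr pair_finite_verts order_refl connected_set_pverts[OF G(2)] assms(2)] .
  then show ?thesis using graph_diameter_le by fastforce
qed

lemma diameter_path_square_ge:
  assumes "2 ^ Suc m \<le> n"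
  shows "ereal (real (m * 2 ^ m) / 8) \<le>
    graph_diameter (with_proj (rotation_graph (with_proj (path_square_graph n))))"
proof -
  interpret G: pair_graph "path_square_graph n" by (rule pair_graph_path_square)
  interpret P: path_square n .
  obtain S T where ST: "P.stree {..<n} S" "P.stree {..<n} T"
    "\<And>d. (S, T) \<in> {(S, T). P.stree {..<n} S \<and> P.stree {..<n} T \<and> P.rotation S T} ^^ d \<Longrightarrow> m * 2 ^ m \<le> 8 * d"
    using P.rotation_distance_ge[OF assms] by blast
  show ?thesis
  proof (rule G.graph_diameter_ge[of S T])
    fix d assume "(S, T) \<in> G.rotation_rel ^^ d"
    then have "m * 2 ^ m \<le> 8 * d" using ST(3) by simp
    then have "real (m * 2 ^ m) \<le> real (8 * d)" by (rule of_nat_mono)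
    then show "real (m * 2 ^ m) / 8 \<le> real d" by simp
  qed (use ST in simp_all)
qed

lemma max_diameter_le:
  assumes "n \<ge> 2"
  shows "\<bar>max_diameter pathwidth_two_graphs n\<bar> \<le> 12 / ln 2 * (real n * ln (real n))"
    and "G \<in> pathwidth_two_graphs \<Longrightarrow> card (pverts G) = n \<Longrightarrow>
      ereal c \<le> graph_diameter (with_proj (rotation_graph (with_proj G))) \<Longrightarrow>
      c \<le> max_diameter pathwidth_two_graphs n"
proof -
  define D where "D = (SUP G \<in> {G \<in> pathwidth_two_graphs. card (pverts G) = n}.
    graph_diameter (with_proj (rotation_graph (with_proj G))))"
  have max: "max_diameter pathwidth_two_graphs n = real_of_ereal D"
    by (simp add: max_diameter_def D_def)
  obtain k where k: "2 ^ k \<le> n" "n < 2 ^ Suc k" using ex_power_ivl1[of 2 n] assms by auto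
  have "real k \<le> log 2 n" using k(1) assms by (simp add: le_log2_of_power)
  then have k_le: "real k \<le> ln n / ln 2" by (simp add: log_def)
  have "ln 2 \<le> ln (real n)" using assms by simp
  then have one: "1 \<le> ln (real n) / ln 2" by (simp add: le_divide_eq)
  \<comment> \<open>As \<open>n \<ge> 2\<close>, the additive 6 is absorbed by a second copy of the
    logarithm, which turns 6 into 12.\<close>
  have "6 * real (Suc k) = 6 * real k + 6" by simp
  with k_le one have "6 * Suc k \<le> 12 * (ln n / ln 2)" by linarith
  then have "6 * Suc k * real n \<le> 12 * (ln n / ln 2) * n"
    by (intro mult_right_mono) auto
  then have bound: "6 * Suc k * real n \<le> 12 / ln 2 * (n * ln n)" by (simp add: mult_ac)
  have D_le: "D \<le> ereal (6 * Suc k * n)"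
    unfolding D_def using diameter_pathwidth_two_le[of _ "Suc k"] k(2) by (intro SUP_least) auto
  have ge: "ereal c \<le> D" if "G \<in> pathwidth_two_graphs" "card (pverts G) = n"
    "ereal c \<le> graph_diameter (with_proj (rotation_graph (with_proj G)))" for G c
    unfolding D_def using that by (intro SUP_upper2[of G]) auto
  show "c \<le> max_diameter pathwidth_two_graphs n" if "G \<in> pathwidth_two_graphs" "card (pverts G) = n"
    "ereal c \<le> graph_diameter (with_proj (rotation_graph (with_proj G)))"
    \<comment> \<open>\<open>D\<close> lies between two real numbers, so passing to its real value
      preserves the order.\<close>
    unfolding max using ge[OF that] D_le by (cases D) auto
  \<comment> \<open>An empty family gives \<open>-\<infinity>\<close>, whose real value is 0;
    otherwise the existence of one search tree makes \<open>D\<close> non-negative.\<close>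
  have "D = -\<infinity> \<or> 0 \<le> D"
  proof (cases "{G \<in> pathwidth_two_graphs. card (pverts G) = n} = {}")
    case True
    then show ?thesis unfolding D_def True by (simp add: bot_ereal_def)
  next
    case False
    then obtain G where G: "G \<in> pathwidth_two_graphs" "card (pverts G) = n" by blast
    then interpret pair_graph G by (simp add: pathwidth_two_graphs_def)
    have "rel.stree (pverts G) (rel.elim_tree (sorted_list_of_set (pverts G)) (pverts G))"
      using G(2) assms pair_finite_verts by (intro rel.stree_elim_tree) auto
    then have "ereal 0 \<le> graph_diameter (with_proj (rotation_graph (with_proj G)))"
      by (rule graph_diameter_ge) (use \<open>rel.stree _ _\<close> in auto)
    then show ?thesis using ge[OF G, of 0] by (simp add: zero_ereal_def)
  qed
  then have "\<bar>real_of_ereal D\<bar> \<le> 6 * Suc k * real n" using D_le by (cases D) auto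
  then show "\<bar>max_diameter pathwidth_two_graphs n\<bar> \<le> 12 / ln 2 * (real n * ln (real n))"
    unfolding max using bound by linarith
qed

lemma max_diameter_ge:
  assumes "n \<ge> 16"
  shows "1 / (64 * ln 2) * (real n * ln (real n)) \<le> max_diameter pathwidth_two_graphs n"
proof -
  obtain k where k: "2 ^ k \<le> n" "n < 2 ^ Suc k" using ex_power_ivl1[of 2 n] assms by auto
  have "k \<noteq> 0" using k(2) assms by (cases k) auto
  then obtain m where m: "k = Suc m" by (cases k) auto
  have "path_square_graph n \<in> pathwidth_two_graphs"
    using assms pair_graph_path_square connected_path_square pathwidth_path_square
    by (simp add: pathwidth_two_graphs_def)
  moreover have "ereal (real (m * 2 ^ m) / 8) \<le>
      graph_diameter (with_proj (rotation_graph (with_proj (path_square_graph n))))"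
    using diameter_path_square_ge[of m n] k(1) m by simp
  ultimately have ge: "real (m * 2 ^ m) / 8 \<le> max_diameter pathwidth_two_graphs n"
    using assms by (intro max_diameter_le(2)) auto
  have n_less: "n < 2 ^ (m + 2)" using k(2) m by simp
  then have "log 2 n < real (m + 2)" using assms by (intro log2_of_power_less) auto
  moreover have "4 \<le> log 2 n" using assms by (simp add: le_log_iff)
  \<comment> \<open>The threshold 16 makes \<open>log 2 n - 2\<close>, which is less than
    \<open>m\<close>, at least half of \<open>log 2 n\<close>.\<close>
  ultimately have m_ge: "log 2 n / 2 \<le> m" by linarith
  have "real n < real (2 ^ (m + 2))" using n_less by (rule of_nat_less_iff[THEN iffD2])
  then have "real n / 4 \<le> 2 ^ m" by simp
  then have "log 2 n / 2 * (n / 4) \<le> real m * 2 ^ m" using m_ge by (intro mult_mono) auto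
  \<comment> \<open>The 64 collects the losses: 2 in \<open>m\<close>, 4 in \<open>2 ^ m\<close>,
    and 8 in the rotation distance.\<close>
  then have "log 2 n * n / 64 \<le> real (m * 2 ^ m) / 8" by (simp add: mult_ac)
  then show ?thesis using ge by (simp add: log_def mult_ac)
qed

theorem theorem7:
  shows "max_diameter pathwidth_two_graphs \<in> \<Theta>(\<lambda>n. real n * ln (real n))"
proof (rule bigthetaI)
  show "max_diameter pathwidth_two_graphs \<in> O(\<lambda>n. real n * ln (real n))"
  proof (rule landau_o.bigI[of "12 / ln 2"])
    show "\<forall>\<^sub>F n in sequentially. norm (max_diameter pathwidth_two_graphs n)
        \<le> 12 / ln 2 * norm (real n * ln (real n))"
      using eventually_ge_at_top[of 2]
    proof eventually_elim
      case (elim n)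
      then show ?case using max_diameter_le(1)[of n] by (simp add: abs_of_nonneg)
    qed
  qed simp
  show "max_diameter pathwidth_two_graphs \<in> \<Omega>(\<lambda>n. real n * ln (real n))"
  proof (rule landau_omega.bigI[of "1 / (64 * ln 2)"])
    show "\<forall>\<^sub>F n in sequentially. norm (max_diameter pathwidth_two_graphs n)
        \<ge> 1 / (64 * ln 2) * norm (real n * ln (real n))"
      using eventually_ge_at_top[of 16]
    proof eventually_elim
      case (elim n)
      then have "norm (real n * ln (real n)) = real n * ln (real n)" by simp
      then show ?case using max_diameter_ge[OF elim] by simp
    qed
  qed simp
qed

end
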